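(* Let $\mathbb D=\{z\in\mathbb C:|z|<1\}$ and let $(c_n)_{n=0}^\infty$ be a bounded sequence in $\mathbb C$. Let $H=(h_{i,j})_{i,j\in\mathbb N_0}$ with $h_{i,j}=c_{i+j}$, and let $g(z)=\sum_{n=0}^\infty(n+2)(n+1)c_nz^n$ for $z\in\mathbb D$. Then the following are equivalent: (i) $H$ is of trace class; (ii) $g\in L^1(\mathbb D)$. If these hold, then $$h_{i,j}=\frac1\pi\int_{\mathbb D}g(\bar z)z^{i+j}(1-|z|^2)\,dz_1\,dz_2\qquad(i,j\in\mathbb N_0),$$ where $z_1=\Re z$, $z_2=\Im z$, and $\|H\|_1\leq\|g\|_1\leq\frac8\pi\|H\|_1$.
   Context: $\|g\|_1=\frac1\pi\int_{\mathbb D}|g(z)|\,dz_1\,dz_2$ (normalized Lebesgue measure on $\mathbb D$); $\|H\|_1$ is the trace class norm of $H$ as an operator on $\ell^2(\mathbb N_0)$. *)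

theory Defs
  imports "HOL-Analysis.Analysis"
begin

text \<open>Infinite matrices indexed by nat x nat, acting on l2(N0) by
  (A x) i = sum over j of A i j * x j.\<close>

definition ell2 :: "(nat \<Rightarrow> complex) set" where
  "ell2 = {x. summable (\<lambda>n. (cmod (x n))^2)}"

text \<open>Operator norm of an infinite matrix as an operator on l2(N0), computed via the
  associated sesquilinear form on finitely supported vectors (value \<infinity> iff unbounded).\<close>
definition mat_norm :: "(nat \<Rightarrow> nat \<Rightarrow> complex) \<Rightarrow> ennreal" where
  "mat_norm A = (SUP p \<in> {(N, x, y). (\<Sum>j<N. (cmod (x j))^2) \<le> 1 \<and> (\<Sum>i<N. (cmod (y i))^2) \<le> 1}.
      (case p of (N, x, y) \<Rightarrow> ennreal (cmod (\<Sum>i<N. \<Sum>j<N. cnj (y i) * A i j * x j))))"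

definition rank_le :: "nat \<Rightarrow> (nat \<Rightarrow> nat \<Rightarrow> complex) \<Rightarrow> bool" where
  "rank_le n F \<longleftrightarrow> (\<exists>u v. (\<forall>k<n. u k \<in> ell2 \<and> v k \<in> ell2) \<and>
      (\<forall>i j. F i j = (\<Sum>k<n. u k i * v k j)))"

definition sing_num :: "(nat \<Rightarrow> nat \<Rightarrow> complex) \<Rightarrow> nat \<Rightarrow> ennreal" where
  "sing_num A n = (INF F \<in> {F. rank_le n F}. mat_norm (\<lambda>i j. A i j - F i j))"

definition trace_norm :: "(nat \<Rightarrow> nat \<Rightarrow> complex) \<Rightarrow> ennreal" where
  "trace_norm A = (\<Sum>n. sing_num A n)"

definition trace_class :: "(nat \<Rightarrow> nat \<Rightarrow> complex) \<Rightarrow> bool" where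
  "trace_class A \<longleftrightarrow> trace_norm A < \<infinity>"

definition disc_L1_norm :: "(complex \<Rightarrow> complex) \<Rightarrow> ennreal" where
  "disc_L1_norm g = ennreal (1 / pi) * (\<integral>\<^sup>+ z. indicator (ball 0 1) z * ennreal (cmod (g z)) \<partial>lborel)"

end

theory Submission
  imports Defs
begin

text \<open>Both bounds compare \<open>H\<close> with its \<open>N \<times> N\<close> truncations, for which a singular value
  decomposition is obtained by repeatedly splitting off a maximizing pair of unit vectors.

  Upper bound for \<open>g\<close>: the square of \<open>\<phi>(z) = \<Sum> \<phi>\<^sub>i z ^ i = sqrt 2 (1 - z) powr (-3/2)\<close> has the coefficients
  \<open>(n + 1) (n + 2)\<close>, so \<open>g\<close> is the limit of \<open>\<Sum>i,j<N. \<phi>\<^sub>i \<phi>\<^sub>j H i j z ^ (i + j)\<close>. A rank one matrix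
  \<open>a\<^sub>i b\<^sub>j\<close> contributes a product of two functions in the Bergman space, of norm at most \<open>8 / pi\<close>
  since \<open>\<phi>\<^sub>i\<^sup>2 \<le> 8 / pi * (i + 1)\<close> by log-convexity of the Gamma function. Sum over the singular
  vectors, bound the singular values by the approximation numbers and apply Fatou's lemma.

  Upper bound for \<open>H\<close>: the integral formula writes \<open>H\<close> as an average of rank one matrices of trace
  norm 1 with total weight \<open>\<parallel>g\<parallel>\<^sub>1\<close>. Pairing with the singular vectors of a truncation and using
  Bessel's inequality bounds the sum of its singular values, and the truncations converge
  to \<open>H\<close> in operator norm.\<close>

subsection \<open>Singular values of finite matrices\<close>

text \<open>\<open>trace_norm\<close> is defined through approximation by matrices of finite rank,
  so no singular value decomposition of \<open>H\<close> itself is at hand. Truncations suffice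
  because of two comparisons. The k-th singular value of a truncation is at most
  \<open>sing_num H k\<close>, whatever the entries outside the block, so the bound on g needs no
  convergence of matrices. In the bound on \<open>H\<close> the truncation error enters once for
  each singular number; hence K of them are summed, the size N tends to infinity with K fixed, and
  only then K grows. The constant 8 / pi is 2 / Gamma(3/2)^2. It is the limit of \<phi>(i)^2 / (i +
  1) for the coefficients \<phi>(i) of \<phi>, so it is the best constant in this estimate of the
  weights. The factor 1 - |z|^2 normalizes the rank one matrix z^(i + j), whose norm is the
  geometric sum of the |z|^(2 i).\<close>

definition ip :: "nat \<Rightarrow> (nat \<Rightarrow> complex) \<Rightarrow> (nat \<Rightarrow> complex) \<Rightarrow> complex" where
  "ip N x y = (\<Sum>i<N. cnj (x i) * y i)"

definition nsq :: "nat \<Rightarrow> (nat \<Rightarrow> complex) \<Rightarrow> real" where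
  "nsq N x = (\<Sum>i<N. (cmod (x i))\<^sup>2)"

text \<open>The form in \<open>mat_norm\<close> at one fixed size. Vectors are functions on
  \<open>nat\<close> of which only the entries below \<open>N\<close> are read, so all sizes share
  one type.\<close>

definition bil :: "nat \<Rightarrow> (nat \<Rightarrow> nat \<Rightarrow> complex) \<Rightarrow> (nat \<Rightarrow> complex) \<Rightarrow> (nat \<Rightarrow> complex) \<Rightarrow> complex" where
  "bil N A y x = (\<Sum>i<N. \<Sum>j<N. cnj (y i) * A i j * x j)"

definition mulv :: "nat \<Rightarrow> (nat \<Rightarrow> nat \<Rightarrow> complex) \<Rightarrow> (nat \<Rightarrow> complex) \<Rightarrow> nat \<Rightarrow> complex" where
  "mulv N A x i = (\<Sum>j<N. A i j * x j)"

lemma nsq_nonneg [simp]: "0 \<le> nsq N x"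
  by (simp add: nsq_def sum_nonneg)

lemma ip_self: "ip N x x = of_real (nsq N x)"
  unfolding ip_def nsq_def of_real_sum by (intro sum.cong refl) (simp add: complex_norm_square mult.commute flip: of_real_power)

lemma cnj_ip: "cnj (ip N x y) = ip N y x"
  by (simp add: ip_def mult.commute)

lemma ip_diff: "ip N x (\<lambda>i. y i - z i) = ip N x y - ip N x z"
  by (simp add: ip_def right_diff_distrib sum_subtractf)

lemma ip_diff_left: "ip N (\<lambda>i. y i - z i) x = ip N y x - ip N z x"
  by (simp add: ip_def left_diff_distrib sum_subtractf)

lemma ip_scale: "ip N x (\<lambda>i. a * y i) = a * ip N x y"
  by (simp add: ip_def sum_distrib_left mult.left_commute)

lemma ip_scale_left: "ip N (\<lambda>i. a * x i) y = cnj a * ip N x y"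
  by (simp add: ip_def sum_distrib_left mult.assoc)

lemma ip_sum: "ip N x (\<lambda>i. \<Sum>k\<in>S. f k i) = (\<Sum>k\<in>S. ip N x (f k))"
  by (simp add: ip_def sum_distrib_left sum.swap[of _ S])

lemma ip_sum_left: "ip N (\<lambda>i. \<Sum>k\<in>S. f k i) x = (\<Sum>k\<in>S. ip N (f k) x)"
  by (simp add: ip_def sum_distrib_right sum.swap[of _ S])

lemma ip_cong: "(\<And>i. i < N \<Longrightarrow> x i = x' i) \<Longrightarrow> (\<And>i. i < N \<Longrightarrow> y i = y' i) \<Longrightarrow> ip N x y = ip N x' y'"
  by (simp add: ip_def)

lemma bil_ip: "bil N A y x = ip N y (mulv N A x)"
  by (simp add: bil_def ip_def mulv_def sum_distrib_left mult.assoc)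

lemma nsq_scale: "nsq N (\<lambda>i. a * x i) = (cmod a)\<^sup>2 * nsq N x"
  by (simp add: nsq_def norm_mult power_mult_distrib sum_distrib_left)

lemma nsq_zero_iff: "nsq N x = 0 \<longleftrightarrow> (\<forall>i<N. x i = 0)"
  by (auto simp: nsq_def sum_nonneg_eq_0_iff)

lemma bil_scale: "bil N A (\<lambda>i. a * y i) (\<lambda>i. b * x i) = cnj a * b * bil N A y x"
  by (simp add: bil_def sum_distrib_left mult_ac)

lemma bil_adjoint: "bil N (\<lambda>i j. cnj (A j i)) x y = cnj (bil N A y x)"
  by (simp add: bil_def mult_ac, rule sum.swap)

text \<open>The factors \<open>nsq N (e l)\<close> stay because singular vectors for the value zero
  will be zero vectors: the families are orthogonal, but not always orthonormal.\<close>

lemma ip_orthogonal_sum: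
  assumes "finite S" and orth: "\<And>k l. k \<noteq> l \<Longrightarrow> ip N (e k) (e l) = 0"
  shows "ip N (\<lambda>j. \<Sum>l\<in>S. t l * e l j) (\<lambda>j. \<Sum>l\<in>S. a l * e l j) = (\<Sum>l\<in>S. cnj (t l) * a l * of_real (nsq N (e l)))"
proof -
  have "ip N (\<lambda>j. \<Sum>l\<in>S. t l * e l j) (\<lambda>j. \<Sum>l\<in>S. a l * e l j)
     = (\<Sum>m\<in>S. a m * (\<Sum>l\<in>S. cnj (t l) * ip N (e l) (e m)))"
    by (simp add: ip_sum ip_sum_left ip_scale ip_scale_left sum_distrib_left)
  also have "\<dots> = (\<Sum>m\<in>S. a m * (\<Sum>l\<in>S. if l = m then cnj (t m) * of_real (nsq N (e m)) else 0))"
    by (intro sum.cong refl arg_cong2[of _ _ _ _ "(*)"]) (auto simp: orth ip_self)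
  also have "\<dots> = (\<Sum>l\<in>S. cnj (t l) * a l * of_real (nsq N (e l)))"
    using assms(1) by (simp add: mult_ac)
  finally show ?thesis .
qed

section \<open>Maximizing pairs of unit vectors\<close>

lemma compact_ball_coordinates:
  "compact {x. (\<forall>i\<ge>N. x i = (0::complex)) \<and> nsq N x \<le> 1}" (is "compact ?S")
proof -
  \<comment> \<open>In the product topology a product of compact discs is compact. Beyond
    \<open>N\<close> the factor is a single point, since coordinates left free there would destroy
    compactness.\<close>
  let ?K = "PiE UNIV (\<lambda>i. if i < N then cball 0 1 else {0::complex})"
  have "compactin (product_topology (\<lambda>i. euclidean) UNIV) ?K"
    by (simp add: compactin_PiE)
  then have K: "compact ?K"
    by (simp add: euclidean_product_topology)
  have "continuous_on UNIV (\<lambda>x. nsq N x)"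
    unfolding nsq_def by (intro continuous_intros continuous_on_product_coordinates)
  then have c: "closed {x. nsq N x \<le> 1}"
    by (intro closed_Collect_le continuous_intros)
  have "?S = ?K \<inter> {x. nsq N x \<le> 1}"
  proof (intro set_eqI iffI)
    fix x assume x: "x \<in> ?S"
    have "cmod (x i) \<le> 1" if "i < N" for i
    proof -
      have "(cmod (x i))\<^sup>2 \<le> nsq N x"
        unfolding nsq_def by (rule member_le_sum) (use that in auto)
      with x have "(cmod (x i))\<^sup>2 \<le> 1\<^sup>2" by simp
      then show ?thesis by (rule power2_le_imp_le) simp
    qed
    with x show "x \<in> ?K \<inter> {x. nsq N x \<le> 1}" by (auto simp: PiE_iff)
  next
    fix x assume "x \<in> ?K \<inter> {x. nsq N x \<le> 1}"
    then show "x \<in> ?S" by (auto simp: PiE_iff) (metis not_le singletonD)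
  qed
  with K c show ?thesis by (simp add: compact_Int_closed)
qed

lemma bil_max_attained:
  obtains x y where "\<forall>i\<ge>N. x i = 0" "\<forall>i\<ge>N. y i = 0" "nsq N x \<le> 1" "nsq N y \<le> 1"
    "\<And>u v. nsq N u \<le> 1 \<Longrightarrow> nsq N v \<le> 1 \<Longrightarrow> cmod (bil N A v u) \<le> cmod (bil N A y x)"
proof -
  let ?S = "{x. (\<forall>i\<ge>N. x i = (0::complex)) \<and> nsq N x \<le> 1}"
  have c: "compact (?S \<times> ?S)" by (intro compact_Times compact_ball_coordinates)
  have ne: "?S \<times> ?S \<noteq> {}" by (auto intro!: exI[of _ "\<lambda>_. 0"] simp: nsq_def)
  have cont1: "continuous_on (?S \<times> ?S) (\<lambda>p. fst p i)" "continuous_on (?S \<times> ?S) (\<lambda>p. snd p i)" for i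
    by (rule continuous_on_product_then_coordinatewise, intro continuous_intros)+
  have cont: "continuous_on (?S \<times> ?S) (\<lambda>p. cmod (bil N A (snd p) (fst p)))"
    unfolding bil_def by (intro continuous_intros cont1)
  obtain p where p: "p \<in> ?S \<times> ?S" "\<forall>q\<in>?S \<times> ?S. cmod (bil N A (snd q) (fst q)) \<le> cmod (bil N A (snd p) (fst p))"
    using continuous_attains_sup[OF c ne cont] by blast
  show ?thesis
  proof (rule that[of "fst p" "snd p"])
    fix u v assume uv: "nsq N u \<le> 1" "nsq N v \<le> 1"
    let ?r = "\<lambda>u i. if i < N then u i else 0"
    have "(?r u, ?r v) \<in> ?S \<times> ?S" using uv by (auto simp: nsq_def)
    with p have "cmod (bil N A (?r v) (?r u)) \<le> cmod (bil N A (snd p) (fst p))" by fastforce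
    moreover have "bil N A (?r v) (?r u) = bil N A v u" by (simp add: bil_def)
    ultimately show "cmod (bil N A v u) \<le> cmod (bil N A (snd p) (fst p))" by simp
  qed (use p in auto)
qed

lemma bil_bound_homogeneous:
  assumes "\<And>u v. nsq N u \<le> 1 \<Longrightarrow> nsq N v \<le> 1 \<Longrightarrow> cmod (bil N A v u) \<le> M"
  shows "cmod (bil N A v u) \<le> M * (sqrt (nsq N v) * sqrt (nsq N u))"
proof (cases "nsq N u = 0 \<or> nsq N v = 0")
  case True
  then have "bil N A v u = 0" unfolding nsq_zero_iff by (auto simp: bil_def)
  with True show ?thesis by auto
next
  case False
  define a b where "a = sqrt (nsq N u)" and "b = sqrt (nsq N v)"
  have ab: "a > 0" "b > 0" "a\<^sup>2 = nsq N u" "b\<^sup>2 = nsq N v"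
    using False nsq_nonneg[of N u] nsq_nonneg[of N v] by (auto simp: a_def b_def less_le)
  have "cmod (bil N A (\<lambda>i. of_real (1 / b) * v i) (\<lambda>i. of_real (1 / a) * u i)) \<le> M"
    using ab by (intro assms) (simp_all only: nsq_scale, simp_all add: norm_divide power_divide)
  also have "bil N A (\<lambda>i. of_real (1 / b) * v i) (\<lambda>i. of_real (1 / a) * u i) = of_real (1 / (b * a)) * bil N A v u"
    by (simp only: bil_scale, simp)
  finally have "cmod (bil N A v u) / (b * a) \<le> M"
    using ab by (simp add: norm_mult norm_divide)
  then show ?thesis using ab by (simp add: pos_divide_le_eq a_def b_def)
qed

text \<open>The equality case of Cauchy-Schwarz: \<open>mulv N A x\<close> has norm at most
  \<open>M\<close>, and its inner product with the unit vector \<open>y\<close> is already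
  \<open>M\<close>, so its squared distance from \<open>M\<close> times \<open>y\<close> is at most
  M^2 - 2 M^2 + M^2 = 0.\<close>

lemma max_right_vector:
  assumes M: "M > 0" and bound: "\<And>u v. cmod (bil N A v u) \<le> M * (sqrt (nsq N v) * sqrt (nsq N u))"
    and xy: "nsq N x = 1" "nsq N y = 1" "bil N A y x = of_real M"
    and i: "i < N"
  shows "mulv N A x i = of_real M * y i"
proof -
  let ?w = "mulv N A x"
  \<comment> \<open>Taking \<open>?w\<close> itself as the left vector bounds the norm of
    \<open>?w\<close> by \<open>M\<close>.\<close>
  have "cmod (bil N A ?w x) \<le> M * sqrt (nsq N ?w)" using bound[of ?w x] xy by simp
  then have 1: "nsq N ?w \<le> M * sqrt (nsq N ?w)" by (simp add: bil_ip ip_self)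
  have 2: "nsq N ?w \<le> M\<^sup>2"
  proof (cases "nsq N ?w = 0")
    case False
    then have p: "sqrt (nsq N ?w) > 0" using nsq_nonneg[of N ?w] by (simp add: less_le)
    have "sqrt (nsq N ?w) * sqrt (nsq N ?w) \<le> M * sqrt (nsq N ?w)" using 1 by simp
    with p have "sqrt (nsq N ?w) \<le> M" by (rule mult_right_le_imp_le[rotated])
    then show ?thesis by (simp add: sqrt_le_D)
  qed simp
  have yw: "ip N y ?w = of_real M" using xy by (simp add: bil_ip)
  then have wy: "ip N ?w y = of_real M" using cnj_ip[of N y ?w] by simp
  let ?d = "\<lambda>i. ?w i - of_real M * y i"
  have "of_real (nsq N ?d) = ip N ?d ?d" by (simp add: ip_self)
  also have "\<dots> = complex_of_real (nsq N ?w - M\<^sup>2)"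
    by (simp add: ip_diff ip_diff_left ip_scale ip_scale_left yw wy) (simp add: ip_self xy power2_eq_square)
  finally have "nsq N ?d = nsq N ?w - M\<^sup>2" using of_real_eq_iff by blast
  with 2 have "nsq N ?d = 0" using nsq_nonneg[of N ?d] by linarith
  with i show ?thesis unfolding nsq_zero_iff by simp
qed

text \<open>For the value zero the vectors are set to zero instead of arbitrary unit vectors. Then
  deflation can go on for ever, and orthogonality survives once the values have vanished.\<close>

lemma top_singular_pair:
  obtains \<sigma> x y where "\<sigma> \<ge> 0" "\<forall>i\<ge>N. x i = 0" "\<forall>i\<ge>N. y i = 0"
    "\<And>u v. cmod (bil N A v u) \<le> \<sigma> * (sqrt (nsq N v) * sqrt (nsq N u))"
    "\<And>i. i < N \<Longrightarrow> mulv N A x i = of_real \<sigma> * y i"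
    "\<And>j. j < N \<Longrightarrow> (\<Sum>i<N. cnj (y i) * A i j) = of_real \<sigma> * cnj (x j)"
    "if \<sigma> = 0 then x = (\<lambda>_. 0) \<and> y = (\<lambda>_. 0) else nsq N x = 1 \<and> nsq N y = 1"
proof -
  obtain x0 y where x0y: "\<forall>i\<ge>N. x0 i = 0" "\<forall>i\<ge>N. y i = 0" "nsq N x0 \<le> 1" "nsq N y \<le> 1"
    and max: "\<And>u v. nsq N u \<le> 1 \<Longrightarrow> nsq N v \<le> 1 \<Longrightarrow> cmod (bil N A v u) \<le> cmod (bil N A y x0)"
    using bil_max_attained[of N A] by blast
  define M where "M = cmod (bil N A y x0)"
  note bd = bil_bound_homogeneous[OF max, folded M_def]
  show ?thesis
  proof (cases "M = 0")
    case True
    then have "bil N A v u = 0" for u v using bd[of v u] by simp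
    moreover have "(\<Sum>i<N. cnj (0::complex) * A i j) = 0" for j by simp
    ultimately show ?thesis by (intro that[of 0 "\<lambda>_. 0" "\<lambda>_. 0"]) (auto simp: mulv_def)
  next
    case False
    then have Mpos: "M > 0" by (simp add: M_def)
    \<comment> \<open>A factor of modulus 1 that turns the maximal value of the form into a positive
      real number.\<close>
    define b where "b = of_real M / bil N A y x0"
    have nb: "cmod b = 1" using Mpos by (auto simp: b_def M_def norm_divide)
    define x where "x = (\<lambda>i. b * x0 i)"
    have "bil N A y x = b * bil N A y x0"
      using bil_scale[of N A 1 y b x0] by (simp add: x_def)
    then have Mxy: "bil N A y x = of_real M" using Mpos by (auto simp: b_def M_def)
    have nx: "nsq N x \<le> 1" using x0y by (simp add: x_def nsq_scale nb)
    \<comment> \<open>The bound at the maximizing pair itself forces both vectors to have norm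
      1.\<close>
    have "M \<le> M * (sqrt (nsq N y) * sqrt (nsq N x))" using bd[of y x] Mpos by (simp add: Mxy)
    then have "1 \<le> sqrt (nsq N y) * sqrt (nsq N x)" using Mpos by simp
    moreover have "sqrt (nsq N y) * sqrt (nsq N x) \<le> sqrt (nsq N x)" "sqrt (nsq N y) * sqrt (nsq N x) \<le> sqrt (nsq N y)"
      using nx x0y by (auto intro: mult_left_le_one_le mult_right_le_one_le)
    ultimately have "1 \<le> sqrt (nsq N x)" "1 \<le> sqrt (nsq N y)" by linarith+
    then have n1: "nsq N x = 1" "nsq N y = 1" using nx x0y by auto
    have adj: "cmod (bil N (\<lambda>i j. cnj (A j i)) v u) \<le> M * (sqrt (nsq N v) * sqrt (nsq N u))" for u v
      using bd[of u v] by (simp add: bil_adjoint mult.commute)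
    show ?thesis
    proof (rule that[of M x y])
      fix j assume j: "j < N"
      \<comment> \<open>The relation for the left vector is the one for the right vector of the
        adjoint matrix, with \<open>x\<close> and \<open>y\<close> exchanged.\<close>
      have "mulv N (\<lambda>i j. cnj (A j i)) y j = of_real M * x j"
        using max_right_vector[OF Mpos adj n1(2,1) _ j] Mxy by (simp add: bil_adjoint)
      from arg_cong[OF this, of cnj] show "(\<Sum>i<N. cnj (y i) * A i j) = of_real M * cnj (x j)"
        by (simp add: mulv_def mult.commute)
    next
      show "\<forall>i\<ge>N. x i = 0" using x0y by (simp add: x_def)
    qed (use Mpos bd n1 x0y max_right_vector[OF Mpos bd n1 Mxy] in auto)
  qed
qed

text \<open>Gaussian elimination by induction on the equations. It supplies a vector in the span of
  k + 1 singular vectors that a matrix of rank k annihilates.\<close>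

lemma homogeneous_system_solution:
  fixes a :: "'m \<Rightarrow> 'l \<Rightarrow> 'f::field"
  assumes "finite M" "finite L" "card M < card L"
  shows "\<exists>t. (\<exists>l\<in>L. t l \<noteq> 0) \<and> (\<forall>m\<in>M. (\<Sum>l\<in>L. a m l * t l) = 0)"
  using assms
proof (induction M arbitrary: L a rule: finite_induct)
  case empty
  then have "L \<noteq> {}" by auto
  then show ?case by (auto intro!: exI[of _ "\<lambda>_. 1"])
next
  case (insert m M)
  show ?case
  proof (cases "\<forall>l\<in>L. a m l = 0")
    case True
    obtain t where "\<exists>l\<in>L. t l \<noteq> 0" "\<forall>m\<in>M. (\<Sum>l\<in>L. a m l * t l) = 0"
      using insert.IH[of L a] insert.prems insert.hyps by auto
    with True show ?thesis by (intro exI[of _ t]) auto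
  next
    case False
    then obtain l0 where l0: "l0 \<in> L" "a m l0 \<noteq> 0" by auto
    define L' where "L' = L - {l0}"
    have L: "finite L'" "l0 \<notin> L'" "L = insert l0 L'" "card M < card L'"
      using insert.prems insert.hyps l0 by (auto simp: L'_def)
    \<comment> \<open>Row reduction with pivot \<open>a m l0\<close>: the unknown \<open>l0\<close>
      drops out of the other equations, and \<open>t'\<close> recovers it from equation
      \<open>m\<close>.\<close>
    define a' where "a' = (\<lambda>k l. a k l - a k l0 * a m l / a m l0)"
    obtain t where t: "\<exists>l\<in>L'. t l \<noteq> 0" "\<forall>k\<in>M. (\<Sum>l\<in>L'. a' k l * t l) = 0"
      using insert.IH[of L' a'] L by auto
    define s where "s = (\<Sum>l\<in>L'. a m l * t l)"
    define t' where "t' = t(l0 := - s / a m l0)"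
    have eq: "(\<Sum>l\<in>L. a k l * t' l) = (\<Sum>l\<in>L'. a k l * t l) - a k l0 * s / a m l0" for k
    proof -
      have "(\<Sum>l\<in>L'. a k l * t' l) = (\<Sum>l\<in>L'. a k l * t l)"
        using L by (intro sum.cong) (auto simp: t'_def)
      then show ?thesis using L by (simp add: t'_def)
    qed
    have eq': "(\<Sum>l\<in>L'. a' k l * t l) = (\<Sum>l\<in>L'. a k l * t l) - a k l0 * s / a m l0" for k
      unfolding a'_def s_def sum_distrib_left sum_divide_distrib sum_subtractf[symmetric]
      by (intro sum.cong refl) (simp add: algebra_simps)
    have "(\<Sum>l\<in>L. a m l * t' l) = 0" using l0 by (simp add: eq flip: s_def)
    moreover have "\<forall>k\<in>M. (\<Sum>l\<in>L. a k l * t' l) = 0" using t eq eq' by simp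
    moreover have "\<exists>l\<in>L. t' l \<noteq> 0" using t L by (auto simp: t'_def)
    ultimately show ?thesis by blast
  qed
qed

section \<open>Deflation and the singular value decomposition\<close>

definition deflate :: "(nat \<Rightarrow> nat \<Rightarrow> complex) \<Rightarrow> (nat \<Rightarrow> real) \<Rightarrow> (nat \<Rightarrow> nat \<Rightarrow> complex) \<Rightarrow> (nat \<Rightarrow> nat \<Rightarrow> complex) \<Rightarrow> nat \<Rightarrow> nat \<Rightarrow> nat \<Rightarrow> complex" where
  "deflate A \<sigma> x y k i j = A i j - (\<Sum>l<k. of_real (\<sigma> l) * y l i * cnj (x l j))"

lemma deflate_Suc:
  "deflate A \<sigma> x y (Suc k) i j = deflate A \<sigma> x y k i j - of_real (\<sigma> k) * y k i * cnj (x k j)"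
  by (simp add: deflate_def)

lemma mulv_deflate_Suc:
  "mulv N (deflate A \<sigma> x y (Suc k)) u i = mulv N (deflate A \<sigma> x y k) u i - of_real (\<sigma> k) * ip N (x k) u * y k i"
  unfolding mulv_def deflate_Suc ip_def sum_distrib_left sum_distrib_right sum_subtractf[symmetric]
  by (intro sum.cong refl) (simp add: algebra_simps)

lemma left_deflate_Suc:
  "(\<Sum>i<N. cnj (u i) * deflate A \<sigma> x y (Suc k) i j) =
    (\<Sum>i<N. cnj (u i) * deflate A \<sigma> x y k i j) - of_real (\<sigma> k) * ip N u (y k) * cnj (x k j)"
  unfolding deflate_Suc ip_def sum_distrib_left sum_distrib_right sum_subtractf[symmetric]
  by (intro sum.cong refl) (simp add: algebra_simps)

lemma mulv_deflate:
  "mulv N (deflate A \<sigma> x y k) u i = mulv N A u i - (\<Sum>l<k. of_real (\<sigma> l) * ip N (x l) u * y l i)"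
  by (induction k) (simp add: mulv_def deflate_def, simp add: mulv_deflate_Suc)

text \<open>Only the choice made at each stage is recorded: the k-th triple is a top singular pair
  of what is left of \<open>A\<close> after k subtractions. Orthogonality, monotonicity and the full
  decomposition follow from this.\<close>

locale deflation =
  fixes N :: nat and A :: "nat \<Rightarrow> nat \<Rightarrow> complex" and \<sigma> :: "nat \<Rightarrow> real" and x y :: "nat \<Rightarrow> nat \<Rightarrow> complex"
  assumes \<sigma>_nonneg: "\<sigma> k \<ge> 0"
    and support: "i \<ge> N \<Longrightarrow> x k i = 0" "i \<ge> N \<Longrightarrow> y k i = 0"
    and bil_bound: "cmod (bil N (deflate A \<sigma> x y k) v u) \<le> \<sigma> k * (sqrt (nsq N v) * sqrt (nsq N u))"
    and right_vector: "i < N \<Longrightarrow> mulv N (deflate A \<sigma> x y k) (x k) i = of_real (\<sigma> k) * y k i"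
    and left_vector: "j < N \<Longrightarrow> (\<Sum>i<N. cnj (y k i) * deflate A \<sigma> x y k i j) = of_real (\<sigma> k) * cnj (x k j)"
    and normalized: "if \<sigma> k = 0 then x k = (\<lambda>_. 0) \<and> y k = (\<lambda>_. 0) else nsq N (x k) = 1 \<and> nsq N (y k) = 1"

text \<open>The k-th triple is chosen from a matrix that depends on the earlier triples. The
  recursion therefore runs over the residual matrices alone, with a choice function \<open>S\<close>
  that assigns a top singular pair to every matrix; the triples are read off afterwards.\<close>

lemma deflation_exists:
  obtains \<sigma> x y where "deflation N A \<sigma> x y"
proof -
  define P where "P = (\<lambda>B (\<sigma>, x, y). \<sigma> \<ge> 0 \<and> (\<forall>i\<ge>N. x i = 0) \<and> (\<forall>i\<ge>N. y i = 0) \<and>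
    (\<forall>u v. cmod (bil N B v u) \<le> \<sigma> * (sqrt (nsq N v) * sqrt (nsq N u))) \<and>
    (\<forall>i<N. mulv N B x i = of_real \<sigma> * y i) \<and>
    (\<forall>j<N. (\<Sum>i<N. cnj (y i) * B i j) = of_real \<sigma> * cnj (x j)) \<and>
    (if \<sigma> = 0 then x = (\<lambda>_. 0) \<and> y = (\<lambda>_. 0) else nsq N x = 1 \<and> nsq N y = 1))"
  have "\<forall>B. \<exists>s. P B s"
  proof
    fix B
    have "\<exists>\<sigma> x y. P B (\<sigma>, x, y)"
      unfolding P_def prod.case by (rule top_singular_pair[of N B]) blast
    then show "\<exists>s. P B s" by blast
  qed
  then obtain S where S: "\<And>B. P B (S B)" by metis
  define step where "step = (\<lambda>B i j. case S B of (\<sigma>, x, y) \<Rightarrow> B i j - of_real \<sigma> * y i * cnj (x j))"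
  define Bs where "Bs k = (step ^^ k) A" for k
  define \<sigma> where "\<sigma> k = fst (S (Bs k))" for k
  define x where "x k = fst (snd (S (Bs k)))" for k
  define y where "y k = snd (snd (S (Bs k)))" for k
  have "Bs k = deflate A \<sigma> x y k" for k
  proof (induction k)
    case (Suc k)
    have "Bs (Suc k) = step (Bs k)" by (simp add: Bs_def)
    also have "\<dots> = (\<lambda>i j. Bs k i j - of_real (\<sigma> k) * y k i * cnj (x k j))"
      by (simp add: step_def \<sigma>_def x_def y_def split_beta)
    finally show ?case by (simp add: Suc deflate_def fun_eq_iff)
  qed (simp add: Bs_def deflate_def fun_eq_iff)
  moreover have "P (Bs k) (\<sigma> k, x k, y k)" for k using S[of "Bs k"] by (simp add: \<sigma>_def x_def y_def)
  ultimately have "P (deflate A \<sigma> x y k) (\<sigma> k, x k, y k)" for k by metis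
  then show ?thesis unfolding P_def prod.case by (intro that[of \<sigma> x y] deflation.intro) blast+
qed

context deflation
begin

abbreviation "B k \<equiv> deflate A \<sigma> x y k"

lemma nsq_le_1: "nsq N (x k) \<le> 1" "nsq N (y k) \<le> 1"
  using normalized[of k] by (auto split: if_splits simp: nsq_def)

text \<open>The left relation at stage k moves an inner product with \<open>x k\<close> onto the
  residual \<open>B k\<close>. So whatever \<open>B k\<close> annihilates is orthogonal to
  \<open>x k\<close> unless \<open>\<sigma> k\<close> is zero.\<close>

lemma scaled_ip_right: "of_real (\<sigma> k) * ip N (x k) u = ip N (y k) (mulv N (B k) u)"
proof -
  have "of_real (\<sigma> k) * ip N (x k) u = (\<Sum>j<N. of_real (\<sigma> k) * cnj (x k j) * u j)"
    by (simp add: ip_def sum_distrib_left mult.assoc)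
  also have "\<dots> = (\<Sum>j<N. (\<Sum>i<N. cnj (y k i) * B k i j) * u j)"
    by (intro sum.cong refl) (simp add: left_vector)
  also have "\<dots> = ip N (y k) (mulv N (B k) u)"
    unfolding ip_def mulv_def sum_distrib_left sum_distrib_right mult.assoc by (rule sum.swap)
  finally show ?thesis .
qed

lemma scaled_ip_left: "of_real (\<sigma> k) * ip N u (y k) = (\<Sum>j<N. (\<Sum>i<N. cnj (u i) * B k i j) * x k j)"
proof -
  have "of_real (\<sigma> k) * ip N u (y k) = (\<Sum>i<N. cnj (u i) * mulv N (B k) (x k) i)"
    by (simp add: ip_def sum_distrib_left right_vector mult_ac)
  also have "\<dots> = (\<Sum>j<N. (\<Sum>i<N. cnj (u i) * B k i j) * x k j)"
    unfolding mulv_def sum_distrib_left sum_distrib_right mult.assoc by (rule sum.swap)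
  finally show ?thesis .
qed

text \<open>Subtracting the l-th term annihilates the l-th pair. Later stages do not revive it,
  because what they subtract is a multiple of an inner product that vanishes when the residual
  annihilates the pair.\<close>

lemma null_vectors:
  assumes "l < k"
  shows "(\<forall>i<N. mulv N (B k) (x l) i = 0) \<and> (\<forall>j<N. (\<Sum>i<N. cnj (y l i) * B k i j) = 0)"
  using assms
proof (induction k)
  case (Suc k)
  show ?case
  proof (cases "l = k")
    case True
    have "\<sigma> k = 0 \<or> ip N (x k) (x k) = 1" "\<sigma> k = 0 \<or> ip N (y k) (y k) = 1"
      using normalized[of k] by (auto simp: ip_self split: if_splits)
    then show ?thesis
      by (auto simp: True mulv_deflate_Suc left_deflate_Suc right_vector left_vector)
  next
    case False
    with Suc have IH: "\<forall>i<N. mulv N (B k) (x l) i = 0" "\<forall>j<N. (\<Sum>i<N. cnj (y l i) * B k i j) = 0"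
      by auto
    have "of_real (\<sigma> k) * ip N (x k) (x l) = 0" unfolding scaled_ip_right using IH by (simp add: ip_def)
    moreover have "of_real (\<sigma> k) * ip N (y l) (y k) = 0" using IH by (simp add: scaled_ip_left)
    ultimately show ?thesis using IH by (auto simp: mulv_deflate_Suc left_deflate_Suc)
  qed
qed simp

lemma orthogonal_less:
  assumes "l < k"
  shows "ip N (x k) (x l) = 0" "ip N (y l) (y k) = 0"
proof -
  have "of_real (\<sigma> k) * ip N (x k) (x l) = 0"
    unfolding scaled_ip_right using null_vectors[OF assms] by (simp add: ip_def)
  \<comment> \<open>If \<open>\<sigma> k\<close> is zero it cannot be cancelled, but then
    \<open>x k\<close> is the zero vector.\<close>
  then show "ip N (x k) (x l) = 0" using normalized[of k] by (auto simp: ip_def)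
  have "of_real (\<sigma> k) * ip N (y l) (y k) = 0"
    using null_vectors[OF assms] by (simp add: scaled_ip_left)
  then show "ip N (y l) (y k) = 0" using normalized[of k] by (auto simp: ip_def)
qed

lemma orthogonal:
  assumes "k \<noteq> l"
  shows "ip N (x k) (x l) = 0" "ip N (y k) (y l) = 0"
  using assms orthogonal_less[of k l] orthogonal_less[of l k] cnj_ip[of N "x l" "x k"] cnj_ip[of N "y l" "y k"]
  by (auto simp: linorder_neq_iff)

lemma mulv_singular: "i < N \<Longrightarrow> mulv N A (x k) i = of_real (\<sigma> k) * y k i"
  using mulv_deflate[of N A \<sigma> x y k "x k" i] right_vector[of i k] by (simp add: orthogonal)

lemma bil_singular: "bil N A (y k) (x l) = (if k = l then of_real (\<sigma> k) else 0)"
proof -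
  have "bil N A (y k) (x l) = ip N (y k) (\<lambda>i. of_real (\<sigma> l) * y l i)"
    unfolding bil_ip by (rule ip_cong) (simp_all add: mulv_singular)
  also have "\<dots> = of_real (\<sigma> l) * ip N (y k) (y l)" by (rule ip_scale)
  also have "\<dots> = (if k = l then of_real (\<sigma> k) else 0)"
    using normalized[of k] by (auto simp: orthogonal ip_self split: if_splits)
  finally show ?thesis .
qed

text \<open>The pair of stage k + 1 was already a competitor at stage k, and by orthogonality
  \<open>B k\<close> has the same value on it as \<open>A\<close>.\<close>

lemma \<sigma>_Suc_le: "\<sigma> (Suc k) \<le> \<sigma> k"
proof -
  have "bil N (B k) (y (Suc k)) (x (Suc k)) = bil N A (y (Suc k)) (x (Suc k))"
    unfolding bil_ip by (rule ip_cong) (simp_all add: mulv_deflate orthogonal)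
  then have "\<sigma> (Suc k) \<le> \<sigma> k * (sqrt (nsq N (y (Suc k))) * sqrt (nsq N (x (Suc k))))"
    using bil_bound[of k "y (Suc k)" "x (Suc k)"] by (simp add: bil_singular \<sigma>_nonneg)
  also have "\<dots> \<le> \<sigma> k * 1"
    by (intro mult_left_mono mult_le_one) (auto simp: nsq_le_1 \<sigma>_nonneg)
  finally show ?thesis by simp
qed

lemma \<sigma>_antimono: "k \<le> l \<Longrightarrow> \<sigma> l \<le> \<sigma> k"
  by (rule lift_Suc_antimono_le[of \<sigma>]) (rule \<sigma>_Suc_le)

text \<open>The lower half of the Eckart-Young theorem. In the span of the first k + 1 right
  singular vectors some unit vector is annihilated by the block of \<open>F\<close>, and there
  \<open>A\<close> stretches by at least \<open>\<sigma> k\<close>. Agreement of \<open>H\<close>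
  with \<open>A\<close> on the block lets the bound apply to infinite matrices.\<close>

lemma singular_le_mat_norm:
  assumes H: "\<And>i j. i < N \<Longrightarrow> j < N \<Longrightarrow> H i j = A i j" and F: "rank_le k F"
  shows "ennreal (\<sigma> k) \<le> mat_norm (\<lambda>i j. H i j - F i j)"
proof (cases "\<sigma> k = 0")
  case False
  then have pos: "\<sigma> l > 0" if "l \<le> k" for l
    using \<sigma>_antimono[OF that] \<sigma>_nonneg[of k] by simp
  have n1: "nsq N (x l) = 1" "nsq N (y l) = 1" if "l \<le> k" for l
    using normalized[of l] pos[OF that] by (auto split: if_splits)
  obtain a b where ab: "\<And>i j. F i j = (\<Sum>m<k. a m i * b m j)"
    using F unfolding rank_le_def by auto
  obtain t0 where t0: "\<exists>l\<in>{..k}. t0 l \<noteq> 0" "\<forall>m\<in>{..<k}. (\<Sum>l\<le>k. (\<Sum>j<N. b m j * x l j) * t0 l) = 0"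
    using homogeneous_system_solution[of "{..<k}" "{..k}" "\<lambda>m l. \<Sum>j<N. b m j * x l j"] by auto
  define s where "s = (\<Sum>l\<le>k. (cmod (t0 l))\<^sup>2)"
  have s: "s > 0" unfolding s_def using t0(1) by (auto intro!: sum_pos2)
  define t where "t l = t0 l / of_real (sqrt s)" for l
  have t1: "(\<Sum>l\<le>k. (cmod (t l))\<^sup>2) = 1"
    using s by (simp add: t_def norm_divide power_divide flip: sum_divide_distrib s_def)
  define u where "u j = (\<Sum>l\<le>k. t l * x l j)" for j
  \<comment> \<open>With the same coefficients on the left, the form becomes the sum of the |t l|^2
    * \<sigma> l, an average of numbers that are at least \<open>\<sigma> k\<close>.\<close>
  define v where "v i = (\<Sum>l\<le>k. t l * y l i)" for i
  have ip_comb: "ip N (\<lambda>j. \<Sum>l\<le>k. t l * e l j) (\<lambda>j. \<Sum>l\<le>k. a l * e l j) = (\<Sum>l\<le>k. cnj (t l) * a l)"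
    if "\<And>l m. l \<noteq> m \<Longrightarrow> ip N (e l) (e m) = 0" "\<And>l. l \<le> k \<Longrightarrow> nsq N (e l) = 1" for e a
    using that by (simp add: ip_orthogonal_sum)
  have tt: "(\<Sum>l\<le>k. cnj (t l) * t l) = 1"
    using arg_cong[OF t1, of complex_of_real] by (simp add: complex_norm_square mult.commute del: of_real_power)
  have nu: "nsq N u = 1"
    using ip_comb[of x t] tt orthogonal n1 ip_self[of N u] by (simp flip: u_def)
  have nv: "nsq N v = 1"
    using ip_comb[of y t] tt orthogonal n1 ip_self[of N v] by (simp flip: v_def)
  have bu: "(\<Sum>j<N. b m j * u j) = 0" if "m < k" for m
  proof -
    have "(\<Sum>j<N. b m j * u j) = (\<Sum>l\<le>k. (\<Sum>j<N. b m j * x l j) * t l)"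
      by (simp add: u_def sum_distrib_left sum_distrib_right mult_ac sum.swap[of _ "{..<N}"])
    also have "\<dots> = (\<Sum>l\<le>k. (\<Sum>j<N. b m j * x l j) * t0 l) / of_real (sqrt s)"
      by (simp add: t_def sum_divide_distrib)
    also have "\<dots> = 0" using t0(2) that by simp
    finally show ?thesis .
  qed
  have "mulv N F u i = 0" for i
  proof -
    have "mulv N F u i = (\<Sum>m<k. a m i * (\<Sum>j<N. b m j * u j))"
      by (simp add: mulv_def ab sum_distrib_left sum_distrib_right mult.assoc sum.swap[of _ "{..<N}"])
    then show ?thesis by (simp add: bu)
  qed
  moreover have "mulv N A u i = (\<Sum>l\<le>k. (t l * of_real (\<sigma> l)) * y l i)" if "i < N" for i
  proof -
    have "mulv N A u i = (\<Sum>l\<le>k. t l * mulv N A (x l) i)"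
      by (simp add: mulv_def u_def sum_distrib_left mult_ac sum.swap[of _ "{..<N}"])
    then show ?thesis using that by (simp add: mulv_singular mult_ac)
  qed
  ultimately have "mulv N (\<lambda>i j. H i j - F i j) u i = (\<Sum>l\<le>k. (t l * of_real (\<sigma> l)) * y l i)" if "i < N" for i
    using that H by (simp add: mulv_def left_diff_distrib sum_subtractf)
  then have "bil N (\<lambda>i j. H i j - F i j) v u = ip N v (\<lambda>i. \<Sum>l\<le>k. (t l * of_real (\<sigma> l)) * y l i)"
    unfolding bil_ip by (intro ip_cong) auto
  also have "\<dots> = (\<Sum>l\<le>k. cnj (t l) * (t l * of_real (\<sigma> l)))"
    using ip_comb[of y "\<lambda>l. t l * of_real (\<sigma> l)"] orthogonal n1 by (simp flip: v_def)
  also have "\<dots> = of_real (\<Sum>l\<le>k. (cmod (t l))\<^sup>2 * \<sigma> l)"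
    by (simp add: complex_norm_square mult_ac del: of_real_power)
  finally have "cmod (bil N (\<lambda>i j. H i j - F i j) v u) = (\<Sum>l\<le>k. (cmod (t l))\<^sup>2 * \<sigma> l)"
    by (simp only: norm_of_real) (simp add: sum_nonneg \<sigma>_nonneg)
  also have "\<dots> \<ge> (\<Sum>l\<le>k. (cmod (t l))\<^sup>2 * \<sigma> k)"
    by (intro sum_mono mult_left_mono \<sigma>_antimono) auto
  finally have "\<sigma> k \<le> cmod (bil N (\<lambda>i j. H i j - F i j) v u)"
    using t1 by (simp flip: sum_distrib_right)
  also have "ennreal (cmod (bil N (\<lambda>i j. H i j - F i j) v u)) \<le> mat_norm (\<lambda>i j. H i j - F i j)"
    unfolding mat_norm_def bil_def
    by (rule SUP_upper2[of "(N, u, v)"]) (use nu nv in \<open>auto simp: nsq_def\<close>)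
  finally show ?thesis by (simp add: ennreal_leI)
qed simp

lemma singular_le_sing_num:
  assumes "\<And>i j. i < N \<Longrightarrow> j < N \<Longrightarrow> H i j = A i j"
  shows "ennreal (\<sigma> k) \<le> sing_num H k"
  unfolding sing_num_def by (intro INF_greatest) (use assms singular_le_mat_norm in auto)

text \<open>The block has rank at most \<open>N\<close>, so it can serve as its own approximant. The
  Eckart-Young bound then forces \<open>\<sigma> N\<close> to be zero, and the residual form
  vanishes on coordinate vectors.\<close>

lemma expansion:
  assumes "i < N" "j < N"
  shows "A i j = (\<Sum>l<N. of_real (\<sigma> l) * y l i * cnj (x l j))"
proof -
  define A' where "A' i j = (if i < N \<and> j < N then A i j else 0)" for i j
  have "rank_le N A'"
    unfolding rank_le_def
  proof (rule exI[of _ "\<lambda>k i. if i = k then 1 else 0"], rule exI[of _ A'], intro conjI allI impI)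
    fix k
    show "(\<lambda>i. if i = k then 1 else 0) \<in> ell2"
      unfolding ell2_def by (auto intro!: summable_finite[of "{k}"] split: if_splits)
    show "A' k \<in> ell2"
      unfolding ell2_def by (auto intro!: summable_finite[of "{..<N}"] simp: A'_def split: if_splits)
  qed (auto simp: A'_def if_distrib[of "\<lambda>c. c * _"] cong: if_cong)
  then have "ennreal (\<sigma> N) \<le> mat_norm (\<lambda>i j. A' i j - A' i j)"
    by (rule singular_le_mat_norm[rotated]) (simp add: A'_def)
  also have "\<dots> \<le> 0" unfolding mat_norm_def by (rule SUP_least) auto
  finally have "\<sigma> N = 0" using \<sigma>_nonneg[of N] by (simp add: ennreal_eq_0_iff)
  then have "bil N (B N) (\<lambda>k. if k = i then 1 else 0) (\<lambda>k. if k = j then 1 else 0) = 0"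
    using bil_bound[of N] by simp
  moreover have "bil N (B N) (\<lambda>k. if k = i then 1 else 0) (\<lambda>k. if k = j then 1 else 0) = B N i j"
    using assms by (simp add: bil_def if_distrib[of "\<lambda>c. c * _"] if_distrib[of "\<lambda>c. _ * c"] if_distrib[of cnj] cong: if_cong)
  ultimately show ?thesis by (simp add: deflate_def)
qed

text \<open>\<open>mat_norm\<close> tests vectors of every length, \<open>bil_bound\<close> only
  those of length \<open>N\<close>. The hypothesis makes the residual vanish off the block and
  closes this gap.\<close>

lemma mat_norm_deflate:
  assumes A: "\<And>i j. N \<le> i \<or> N \<le> j \<Longrightarrow> A i j = 0"
  shows "mat_norm (B k) \<le> ennreal (\<sigma> k)"
  unfolding mat_norm_def
proof (intro SUP_least, clarify, rule ennreal_leI)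
  fix M :: nat and u v :: "nat \<Rightarrow> complex"
  assume uv: "(\<Sum>j<M. (cmod (u j))\<^sup>2) \<le> 1" "(\<Sum>i<M. (cmod (v i))\<^sup>2) \<le> 1"
  let ?c = "\<lambda>u (i::nat). if i < M then u i else (0::complex)"
  have nc: "nsq N (?c u) \<le> 1" if "(\<Sum>j<M. (cmod (u j))\<^sup>2) \<le> 1" for u
  proof -
    have "nsq N (?c u) = (\<Sum>i\<in>{..<N} \<inter> {..<M}. (cmod (u i))\<^sup>2)"
      unfolding nsq_def by (intro sum.mono_neutral_cong_right) auto
    also have "\<dots> \<le> (\<Sum>j<M. (cmod (u j))\<^sup>2)" by (intro sum_mono2) auto
    finally show ?thesis using that by simp
  qed
  have B0: "i < N \<and> j < N" if "B k i j \<noteq> 0" for i j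
    using that A support by (cases "N \<le> i \<or> N \<le> j") (auto simp: deflate_def)
  have row0: "i < N" if "(\<Sum>j<M. cnj (v i) * B k i j * u j) \<noteq> 0" for i
    using sum.not_neutral_contains_not_neutral[OF that] B0 by auto
  have "(\<Sum>i<M. \<Sum>j<M. cnj (v i) * B k i j * u j) = (\<Sum>i\<in>{..<N} \<inter> {..<M}. \<Sum>j\<in>{..<N} \<inter> {..<M}. cnj (v i) * B k i j * u j)"
    by (intro sum.mono_neutral_cong_right) (auto dest: B0 row0)
  also have "\<dots> = bil N (B k) (?c v) (?c u)"
    unfolding bil_def by (intro sum.mono_neutral_cong_left) auto
  finally have "cmod (\<Sum>i<M. \<Sum>j<M. cnj (v i) * B k i j * u j) \<le> \<sigma> k * (sqrt (nsq N (?c v)) * sqrt (nsq N (?c u)))"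
    using bil_bound by simp
  also have "\<dots> \<le> \<sigma> k * 1"
    by (intro mult_left_mono mult_le_one) (auto simp: nc uv \<sigma>_nonneg)
  finally show "cmod (\<Sum>i<M. \<Sum>j<M. cnj (v i) * B k i j * u j) \<le> \<sigma> k" by simp
qed

end

text \<open>Expanding the squared distance from \<open>u\<close> to \<open>p\<close> shows that
  norms at most 1 are enough: shorter vectors only decrease the term \<open>ip N p p\<close>. This
  admits the zero vectors of a deflation.\<close>

lemma bessel:
  fixes e :: "nat \<Rightarrow> nat \<Rightarrow> complex"
  assumes orth: "\<And>k l. k \<noteq> l \<Longrightarrow> ip N (e k) (e l) = 0" and le1: "\<And>k. nsq N (e k) \<le> 1"
  shows "(\<Sum>k<K. (cmod (ip N (e k) u))\<^sup>2) \<le> nsq N u"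
proof -
  define a where "a k = ip N (e k) u" for k
  define S where "S = (\<Sum>k<K. (cmod (a k))\<^sup>2)"
  define p where "p i = (\<Sum>k<K. a k * e k i)" for i
  have "ip N u p = (\<Sum>k<K. a k * ip N u (e k))"
    unfolding p_def by (simp add: ip_sum ip_scale)
  also have "\<dots> = of_real S"
    by (simp add: S_def complex_norm_square a_def cnj_ip del: of_real_power)
  finally have up: "ip N u p = of_real S" .
  then have pu: "ip N p u = of_real S" using cnj_ip[of N u p] by simp
  have "ip N p p = (\<Sum>k<K. cnj (a k) * a k * of_real (nsq N (e k)))"
    unfolding p_def by (rule ip_orthogonal_sum[OF finite_lessThan]) (auto simp: orth)
  also have "\<dots> = of_real (\<Sum>k<K. (cmod (a k))\<^sup>2 * nsq N (e k))"
    by (simp add: complex_norm_square mult_ac del: of_real_power)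
  finally have pp: "ip N p p = of_real (\<Sum>k<K. (cmod (a k))\<^sup>2 * nsq N (e k))" .
  have le: "(\<Sum>k<K. (cmod (a k))\<^sup>2 * nsq N (e k)) \<le> S"
    unfolding S_def by (intro sum_mono) (simp add: le1 mult_left_le)
  have "of_real (nsq N (\<lambda>i. u i - p i)) = ip N (\<lambda>i. u i - p i) (\<lambda>i. u i - p i)"
    by (simp add: ip_self)
  also have "\<dots> = complex_of_real (nsq N u - 2 * S + (\<Sum>k<K. (cmod (a k))\<^sup>2 * nsq N (e k)))"
    by (simp only: ip_diff ip_diff_left up pu pp) (simp add: ip_self)
  finally have "nsq N (\<lambda>i. u i - p i) = nsq N u - 2 * S + (\<Sum>k<K. (cmod (a k))\<^sup>2 * nsq N (e k))"
    using of_real_eq_iff by blast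
  with le nsq_nonneg[of N "\<lambda>i. u i - p i"] show ?thesis by (simp add: S_def a_def)
qed

subsection \<open>Moments of the disc\<close>

lemma isometry_ball:
  assumes "\<And>x. norm (T x) = norm x"
  shows "indicator (ball 0 r) (T x) = (indicator (ball 0 r) x :: 'b::zero_neq_one)"
  using assms by (simp add: indicator_def)

lemma nn_integral_lborel_translate:
  fixes f :: "'a::euclidean_space \<Rightarrow> ennreal"
  assumes [measurable]: "f \<in> borel_measurable borel"
  shows "(\<integral>\<^sup>+ x. f (a + x) \<partial>lborel) = (\<integral>\<^sup>+ x. f x \<partial>lborel)"
proof -
  have "(\<integral>\<^sup>+ x. f x \<partial>lborel) = (\<integral>\<^sup>+ x. f x \<partial>distr lborel borel ((+) a))"
    by (simp add: lborel_distr_plus)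
  also have "\<dots> = (\<integral>\<^sup>+ x. f (a + x) \<partial>lborel)"
    by (rule nn_integral_distr) auto
  finally show ?thesis by simp
qed

text \<open>By translation invariance and Fubini, convolving with the indicator of the unit ball, itself
  invariant under isometries, shows that the two integrals agree after multiplication by the
  volume of the ball.\<close>

lemma nn_integral_lborel_isometry:
  fixes f :: "'a::euclidean_space \<Rightarrow> ennreal" and T :: "'a \<Rightarrow> 'a"
  assumes f[measurable]: "f \<in> borel_measurable borel" and T: "linear T" and surj: "surj T"
    and iso: "\<And>x. norm (T x) = norm x"
  shows "(\<integral>\<^sup>+ x. f (T x) \<partial>lborel) = (\<integral>\<^sup>+ x. f x \<partial>lborel)"
proof -
  have [measurable]: "T \<in> borel_measurable borel"
    using T by (intro borel_measurable_continuous_onI linear_continuous_on linear_conv_bounded_linear[THEN iffD1])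
  have [measurable]: "ball (0::'a) 1 \<in> sets borel" by simp
  let ?B = "indicator (ball (0::'a) 1) :: 'a \<Rightarrow> ennreal"
  define V where "V = emeasure lborel (ball (0::'a) 1)"
  have V: "(\<integral>\<^sup>+ y. ?B y \<partial>lborel) = V" by (simp add: V_def)
  have V0: "V \<noteq> 0" "V \<noteq> \<infinity>" unfolding V_def
    using unit_ball_vol_pos[of "real DIM('a)"] by (auto simp: emeasure_ball simp del: unit_ball_vol_pos)
  have "(\<integral>\<^sup>+ x. f (T x) \<partial>lborel) * V = (\<integral>\<^sup>+ x. \<integral>\<^sup>+ y. f (T x) * ?B (- T x + y) \<partial>lborel \<partial>lborel)"
  proof -
    have "(\<integral>\<^sup>+ y. f (T x) * ?B (- T x + y) \<partial>lborel) = f (T x) * V" for x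
    proof -
      have "(\<integral>\<^sup>+ y. ?B (- T x + y) \<partial>lborel) = V"
        unfolding V[symmetric] by (rule nn_integral_lborel_translate) measurable
      moreover have "(\<lambda>y. ?B (- T x + y)) \<in> borel_measurable lborel" by measurable
      ultimately show ?thesis by (metis nn_integral_cmult)
    qed
    then show ?thesis by (simp only:) (rule nn_integral_multc[symmetric], measurable)
  qed
  also have "\<dots> = (\<integral>\<^sup>+ y. \<integral>\<^sup>+ x. f (T x) * ?B (- T x + y) \<partial>lborel \<partial>lborel)"
    by (rule lborel_pair.Fubini') measurable
  also have "\<dots> = (\<integral>\<^sup>+ y. \<integral>\<^sup>+ x. f (T x + y) * ?B x \<partial>lborel \<partial>lborel)"
  proof (rule nn_integral_cong)
    fix y
    \<comment> \<open>Surjectivity turns the shift by \<open>y\<close> after \<open>T\<close> into a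
      shift by \<open>z\<close> before it, where translation invariance applies. Invariance of the
      ball then removes \<open>T\<close> from the second factor.\<close>
    obtain z where z: "y = T z" using surj by auto
    have "(\<integral>\<^sup>+ x. f (T x) * ?B (- T x + y) \<partial>lborel) = (\<integral>\<^sup>+ x. f (T (z + x)) * ?B (- T (z + x) + y) \<partial>lborel)"
      by (rule nn_integral_lborel_translate[symmetric]) measurable
    also have "\<dots> = (\<integral>\<^sup>+ x. f (T x + y) * ?B x \<partial>lborel)"
      by (simp add: linear_add[OF T] z iso indicator_def add.commute)
    finally show "(\<integral>\<^sup>+ x. f (T x) * ?B (- T x + y) \<partial>lborel) = \<dots>" .
  qed
  also have "\<dots> = (\<integral>\<^sup>+ x. \<integral>\<^sup>+ y. f (T x + y) * ?B x \<partial>lborel \<partial>lborel)"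
    by (rule lborel_pair.Fubini') measurable
  also have "\<dots> = (\<integral>\<^sup>+ x. f x \<partial>lborel) * V"
    by (simp add: nn_integral_multc nn_integral_lborel_translate nn_integral_cmult V)
  finally show ?thesis using V0 by (simp add: mult.commute[of _ V] ennreal_mult_cancel_left)
qed

lemma lborel_distr_isometry:
  fixes T :: "'a::euclidean_space \<Rightarrow> 'a"
  assumes "linear T" "surj T" "\<And>x. norm (T x) = norm x"
  shows "distr lborel borel T = lborel"
proof (rule measure_eqI)
  have [measurable]: "T \<in> borel_measurable borel"
    using assms(1) by (intro borel_measurable_continuous_onI linear_continuous_on linear_conv_bounded_linear[THEN iffD1])
  fix A assume "A \<in> sets (distr lborel borel T)"
  then have [measurable]: "A \<in> sets borel" by simp
  have "emeasure (distr lborel borel T) A = (\<integral>\<^sup>+ x. indicator A x \<partial>distr lborel borel T)" by simp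
  also have "\<dots> = (\<integral>\<^sup>+ x. indicator A (T x) \<partial>lborel)" by (rule nn_integral_distr) auto
  also have "\<dots> = (\<integral>\<^sup>+ x. indicator A x \<partial>lborel)" by (rule nn_integral_lborel_isometry) (use assms in auto)
  finally show "emeasure (distr lborel borel T) A = emeasure lborel A" by simp
qed simp

lemma lborel_distr_rotation:
  assumes "cmod u = 1"
  shows "distr lborel borel (\<lambda>z. u * z) = (lborel :: complex measure)"
proof (rule lborel_distr_isometry)
  show "surj (\<lambda>z. u * z)" using assms
    by (intro surjI[of _ "\<lambda>z. z / u"]) auto
qed (use assms in \<open>auto simp: norm_mult intro: linear_times\<close>)

lemma lborel_distr_cnj: "distr lborel borel cnj = lborel"
  by (rule lborel_distr_isometry) (auto intro!: surjI[of cnj cnj] linear_cnj simp del: complex_cnj_cnj simp: complex_cnj_cnj)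

section \<open>Monomials integrated over discs\<close>

lemma nn_integral_ball_power:
  assumes "r > 0"
  shows "(\<integral>\<^sup>+ z. indicator (ball 0 r) z * ennreal (r ^ (2 * n) - cmod z ^ (2 * n)) \<partial>lborel)
    = ennreal (pi * r ^ (2 * n + 2) * n / (n + 1))"
proof -
  \<comment> \<open>A layer-cake argument in place of polar coordinates: the integrand is the
    integral of \<open>?f\<close> from |z| to r, and after the exchange the inner integral is the
    area of a disc. At n = 0 the truncated exponent does no harm, since the factor
    \<open>2 * n\<close> is zero.\<close>
  let ?f = "\<lambda>t. real (2 * n) * t ^ (2 * n - 1)"
  have [measurable]: "ball (0::complex) r \<in> sets borel" by simp
  have FTC: "(\<integral>\<^sup>+ t. ennreal (?f t) * indicator {a..r} t \<partial>lborel) = ennreal (r ^ (2 * n) - a ^ (2 * n))"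
    if "0 \<le> a" "a \<le> r" for a
    using that by (intro nn_integral_FTC_Icc) (auto intro!: derivative_eq_intros)
  have "(\<integral>\<^sup>+ z. indicator (ball 0 r) z * ennreal (r ^ (2 * n) - cmod z ^ (2 * n)) \<partial>lborel)
    = (\<integral>\<^sup>+ z. \<integral>\<^sup>+ t. indicator (ball 0 r) z * (ennreal (?f t) * indicator {cmod z..r} t) \<partial>lborel \<partial>(lborel :: complex measure))"
  proof (rule nn_integral_cong)
    fix z :: complex
    have "(\<integral>\<^sup>+ t. indicator (ball 0 r) z * (ennreal (?f t) * indicator {cmod z..r} t) \<partial>lborel)
       = indicator (ball 0 r) z * (\<integral>\<^sup>+ t. ennreal (?f t) * indicator {cmod z..r} t \<partial>lborel)"
      by (rule nn_integral_cmult) measurable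
    also have "\<dots> = indicator (ball 0 r) z * ennreal (r ^ (2 * n) - cmod z ^ (2 * n))"
    proof (cases "z \<in> ball 0 r")
      case True
      then have "cmod z \<le> r" by simp
      then show ?thesis by (subst FTC) simp_all
    qed simp
    finally show "indicator (ball 0 r) z * ennreal (r ^ (2 * n) - cmod z ^ (2 * n)) =
      (\<integral>\<^sup>+ t. indicator (ball 0 r) z * (ennreal (?f t) * indicator {cmod z..r} t) \<partial>lborel)" by simp
  qed
  also have "\<dots> = (\<integral>\<^sup>+ t. \<integral>\<^sup>+ z. indicator (ball 0 r) z * (ennreal (?f t) * indicator {cmod z..r} t) \<partial>(lborel :: complex measure) \<partial>lborel)"
  proof (rule lborel_pair.Fubini')
    have "{p :: real \<times> complex. cmod (snd p) \<le> fst p \<and> fst p \<le> r} \<in> sets (borel \<Otimes>\<^sub>M borel)"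
      unfolding borel_prod by (intro borel_closed closed_Collect_conj closed_Collect_le continuous_intros)
    then have [measurable]: "{p :: real \<times> complex. cmod (snd p) \<le> fst p \<and> fst p \<le> r} \<in> sets (lborel \<Otimes>\<^sub>M lborel)"
      by (simp add: sets_pair_measure_cong[of lborel borel lborel borel])
    have "(\<lambda>p. indicator (ball 0 r) (snd p) * (ennreal (?f (fst p)) * indicator {p :: real \<times> complex. cmod (snd p) \<le> fst p \<and> fst p \<le> r} p))
        \<in> borel_measurable (lborel \<Otimes>\<^sub>M lborel)"
      by measurable
    then show "(\<lambda>(t, z). indicator (ball 0 r) z * (ennreal (?f t) * indicator {cmod z..r} t)) \<in> borel_measurable (lborel \<Otimes>\<^sub>M lborel)"
      by (rule measurable_cong[THEN iffD1, rotated]) (auto simp: indicator_def)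
  qed
  also have "\<dots> = (\<integral>\<^sup>+ t. ennreal (?f t * (pi * t\<^sup>2)) * indicator {0..r} t \<partial>lborel)"
  proof (rule nn_integral_cong_AE, rule AE_mp[OF AE_lborel_singleton[of r]], rule AE_I2, rule impI)
    \<comment> \<open>At t = r the open ball and \<open>cball 0 t\<close> differ; this single value
      of t is a null set.\<close>
    fix t :: real assume t: "t \<noteq> r"
    have "(\<integral>\<^sup>+ z. indicator (ball 0 r) z * (ennreal (?f t) * indicator {cmod z..r} t) \<partial>(lborel :: complex measure))
       = (\<integral>\<^sup>+ z. ennreal (?f t) * indicator {0..r} t * indicator (cball 0 t) z \<partial>(lborel :: complex measure))"
      using t by (intro nn_integral_cong) (auto simp: indicator_def intro: order_trans[OF norm_ge_zero])
    also have "\<dots> = ennreal (?f t) * indicator {0..r} t * emeasure lborel (cball (0::complex) t)"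
      by (simp add: nn_integral_cmult_indicator)
    also have "\<dots> = ennreal (?f t * (pi * t\<^sup>2)) * indicator {0..r} t"
      by (auto simp: indicator_def emeasure_cball eval_unit_ball_vol ennreal_mult')
    finally show "(\<integral>\<^sup>+ z. indicator (ball 0 r) z * (ennreal (?f t) * indicator {cmod z..r} t) \<partial>(lborel :: complex measure)) = \<dots>" .
  qed
  also have "\<dots> = ennreal (pi * n / (n + 1) * r ^ (2 * n + 2) - pi * n / (n + 1) * 0 ^ (2 * n + 2))"
  proof (rule nn_integral_FTC_Icc)
    fix t :: real
    have "pi * n / (n + 1) * (real (2 * n + 2) * t ^ (2 * n + 2 - 1)) = ?f t * (pi * t\<^sup>2)"
    proof (cases n)
      case (Suc m)
      have "t ^ (2 * n + 2 - 1) = t ^ (2 * n - 1) * t\<^sup>2" by (simp add: Suc power2_eq_square)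
      moreover have "real n / (real n + 1) * real (2 * n + 2) = real (2 * n)" by (simp add: field_simps)
      moreover have "pi * n / (n + 1) * (real (2 * n + 2) * p) = pi * (real n / (real n + 1) * real (2 * n + 2)) * p" for p :: real
        by (simp add: mult_ac add_ac)
      ultimately show ?thesis by (simp only:) simp
    qed simp
    moreover have "((\<lambda>t. pi * n / (n + 1) * t ^ (2 * n + 2)) has_real_derivative pi * n / (n + 1) * (real (2 * n + 2) * t ^ (2 * n + 2 - 1))) (at t)"
      using DERIV_cmult[OF DERIV_pow[of "2 * n + 2" t UNIV]] by (simp only: One_nat_def)
    ultimately show "((\<lambda>t. pi * n / (n + 1) * t ^ (2 * n + 2)) has_real_derivative ?f t * (pi * t\<^sup>2)) (at t)"
      by simp
  qed (use assms in auto)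
  finally show ?thesis by (simp add: mult_ac)
qed

lemma set_integrable_ball_continuous:
  fixes f :: "complex \<Rightarrow> 'b::euclidean_space"
  assumes "continuous_on UNIV f"
  shows "set_integrable lborel (ball 0 r) f"
proof (rule set_integrable_subset[of _ "cball 0 r"])
  show "set_integrable lborel (cball 0 r) f"
    unfolding set_integrable_def
    using borel_integrable_compact[of "cball 0 r" f] continuous_on_subset[OF assms, of "cball 0 r"]
    by (simp add: indicator_scaleR_eq_if)
qed auto

lemma ball_norm_moment:
  assumes "r > 0"
  shows "(LINT z:ball 0 r|lborel. cmod z ^ (2 * n)) = pi * r ^ (2 * n + 2) / (n + 1)"
proof -
  have int: "set_integrable lborel (ball 0 r) (\<lambda>z. cmod z ^ (2 * n))"
      "set_integrable lborel (ball 0 r) (\<lambda>z::complex. r ^ (2 * n))"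
      "set_integrable lborel (ball 0 r) (\<lambda>z. r ^ (2 * n) - cmod z ^ (2 * n))"
    by (intro set_integrable_ball_continuous continuous_intros)+
  have "ennreal (LINT z:ball 0 r|lborel. r ^ (2 * n) - cmod z ^ (2 * n))
      = (\<integral>\<^sup>+ z. ennreal (indicator (ball 0 r) z * (r ^ (2 * n) - cmod z ^ (2 * n))) \<partial>lborel)"
    unfolding set_lebesgue_integral_def
    using int(3) by (subst nn_integral_eq_integral)
      (auto simp: set_integrable_def indicator_def intro!: power_mono)
  also have "\<dots> = ennreal (pi * r ^ (2 * n + 2) * n / (n + 1))"
    unfolding nn_integral_ball_power[OF assms, symmetric]
    by (intro nn_integral_cong) (simp add: indicator_def)
  finally have "(LINT z:ball 0 r|lborel. r ^ (2 * n) - cmod z ^ (2 * n)) = pi * r ^ (2 * n + 2) * n / (n + 1)"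
    using assms unfolding set_lebesgue_integral_def
    by (subst (asm) ennreal_inj) (auto simp: indicator_def intro!: integral_nonneg_AE AE_I2 power_mono)
  moreover have "(LINT z:ball 0 r|lborel. r ^ (2 * n) - cmod z ^ (2 * n))
      = (LINT z:ball (0::complex) r|lborel. r ^ (2 * n)) - (LINT z:ball 0 r|lborel. cmod z ^ (2 * n))"
    using int by (rule_tac set_integral_diff)
  moreover have "(LINT z:ball (0::complex) r|lborel. r ^ (2 * n)) = pi * r ^ (2 * n + 2)"
    using assms by (simp add: set_lebesgue_integral_def content_ball eval_unit_ball_vol measure_def emeasure_ball power_add power2_eq_square)
  moreover have "pi * r ^ (2 * n + 2) - pi * r ^ (2 * n + 2) * n / (n + 1) = pi * r ^ (2 * n + 2) / (n + 1)"
    by (simp add: field_simps)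
  ultimately show ?thesis by linarith
qed

lemma set_integral_ball_isometry:
  fixes f :: "complex \<Rightarrow> 'b::{banach, second_countable_topology}"
  assumes T: "distr lborel borel T = lborel" "T \<in> borel_measurable borel" and iso: "\<And>z. cmod (T z) = cmod z"
    and f: "(\<lambda>z. indicator (ball 0 r) z *\<^sub>R f z) \<in> borel_measurable borel"
  shows "(LINT z:ball 0 r|lborel. f (T z)) = (LINT z:ball 0 r|lborel. f z)"
proof -
  have "(LINT z:ball 0 r|lborel. f z) = (LINT z:ball 0 r|distr lborel borel T. f z)"
    by (simp add: T)
  also have "\<dots> = (LINT z|lborel. indicator (ball 0 r) (T z) *\<^sub>R f (T z))"
    unfolding set_lebesgue_integral_def using T f by (intro integral_distr) auto
  finally show ?thesis by (simp add: set_lebesgue_integral_def isometry_ball[OF iso])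
qed

lemma ball_moment:
  assumes "r > 0"
  shows "(LINT z:ball 0 r|lborel. z ^ m * cnj z ^ n) =
    (if m = n then of_real (pi * r ^ (2 * n + 2) / (n + 1)) else 0)"
proof (cases "m = n")
  case True
  have "z ^ n * cnj z ^ n = of_real (cmod z ^ (2 * n))" for z
    by (simp only: of_real_power power_mult complex_norm_square[symmetric] power_mult_distrib[symmetric])
  then show ?thesis
    by (simp only: True set_integral_complex_of_real ball_norm_moment[OF assms] simp_thms if_True)
next
  case False
  \<comment> \<open>The rotation by \<open>u\<close> multiplies the integrand by u^(m - n) = -1, so
    the integral equals its own negative.\<close>
  define u where "u = cis (pi / (real m - real n))"
  have u: "cmod u = 1" by (simp add: u_def)
  have "u ^ m = cis (real m * (pi / (real m - real n)))" "cnj u ^ n = cis (- (real n * (pi / (real m - real n))))"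
    unfolding u_def cis_cnj by (simp_all only: Complex.DeMoivre mult_minus_right)
  then have "u ^ m * cnj u ^ n = cis (real m * (pi / (real m - real n)) - real n * (pi / (real m - real n)))"
    by (simp only: cis_mult diff_conv_add_uminus)
  also have "real m * (pi / (real m - real n)) - real n * (pi / (real m - real n)) = pi"
    using False by (simp add: divide_simps) (simp add: algebra_simps)
  finally have u1: "u ^ m * cnj u ^ n = -1" by (simp add: cis_pi)
  have [measurable]: "ball (0::complex) r \<in> sets borel" by simp
  let ?I = "LINT z:ball 0 r|lborel. z ^ m * cnj z ^ n"
  have "?I = (LINT z:ball 0 r|lborel. (u * z) ^ m * cnj (u * z) ^ n)"
    by (rule set_integral_ball_isometry[symmetric])
       (auto simp: lborel_distr_rotation u norm_mult intro!: borel_measurable_continuous_on_indicator continuous_intros)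
  also have "\<dots> = (LINT z:ball 0 r|lborel. (u ^ m * cnj u ^ n) * (z ^ m * cnj z ^ n))"
    by (simp add: power_mult_distrib mult_ac)
  also have "\<dots> = - ?I" unfolding u1 by (subst set_integral_mult_right) simp
  finally show ?thesis using False by simp
qed

subsection \<open>The Bergman norm bounded by the trace norm\<close>

text \<open>The Taylor coefficients of \<open>(1 - z) powr (-3/2)\<close>; the square of this series is
  \<open>(1 - z) powr (-3)\<close>, whose coefficients are \<open>(n + 1) (n + 2) / 2\<close>.\<close>

definition bergman_weight :: "nat \<Rightarrow> real" where
  "bergman_weight n = pochhammer (3 / 2) n / fact n"

lemma bergman_weight_nonneg [simp]: "0 \<le> bergman_weight n"
  by (simp add: bergman_weight_def pochhammer_nonneg)

lemma pochhammer_3: "pochhammer (3::real) n / fact n = (real n + 1) * (real n + 2) / 2"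
proof (induction n)
  case (Suc n)
  have "pochhammer (3::real) (Suc n) / fact (Suc n) = (pochhammer 3 n / fact n) * ((3 + real n) / (1 + real n))"
    by (simp add: pochhammer_Suc)
  also have "\<dots> = (real (Suc n) + 1) * (real (Suc n) + 2) / 2"
    unfolding Suc.IH by (simp add: field_simps)
  finally show ?case .
qed simp

lemma bergman_weight_convolution: "(\<Sum>i\<le>n. bergman_weight i * bergman_weight (n - i)) = (real n + 1) * (real n + 2) / 2"
proof -
  have "pochhammer (3 / 2 + 3 / 2 :: real) n = (\<Sum>i\<le>n. of_nat (n choose i) * pochhammer (3/2) i * pochhammer (3/2) (n - i))"
    by (rule pochhammer_binomial_sum)
  then have "pochhammer (3::real) n / fact n = (\<Sum>i\<le>n. of_nat (n choose i) * pochhammer (3/2) i * pochhammer (3/2) (n - i)) / fact n"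
    by simp
  also have "\<dots> = (\<Sum>i\<le>n. bergman_weight i * bergman_weight (n - i))"
    unfolding sum_divide_distrib by (intro sum.cong refl) (simp add: bergman_weight_def binomial_fact field_simps)
  finally show ?thesis using pochhammer_3 by simp
qed

text \<open>The weight is Gamma(n + 3/2) / (Gamma(3/2) n!), and n + 3/2 is the midpoint of n + 1 and
  n + 2. The factor 4 / pi is 1 / Gamma(3/2)^2.\<close>

lemma bergman_weight_square_le: "(bergman_weight n)\<^sup>2 \<le> 4 / pi * (real n + 1)"
proof -
  let ?a = "real n + 1" and ?b = "real n + 2"
  have pos: "Gamma ?a > 0" "Gamma ?b > 0" "Gamma (3 / 2 + real n) > 0"
    by (auto intro!: Gamma_real_pos)
  have "(ln \<circ> Gamma) ((1 - 1/2) *\<^sub>R ?a + (1/2) *\<^sub>R ?b) \<le> (1 - 1/2) * (ln \<circ> Gamma) ?a + (1/2) * (ln \<circ> Gamma) ?b"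
    by (rule convex_onD[OF log_convex_Gamma_real]) auto
  also have "(1 - 1/2) *\<^sub>R ?a + (1/2) *\<^sub>R ?b = 3 / 2 + real n" by (simp add: field_simps)
  finally have "2 * ln (Gamma (3 / 2 + real n)) \<le> ln (Gamma ?a) + ln (Gamma ?b)" by simp
  then have "ln ((Gamma (3 / 2 + real n))\<^sup>2) \<le> ln (Gamma ?a * Gamma ?b)"
    using ln_realpow[of "Gamma (3 / 2 + real n)" 2] ln_mult[of "Gamma ?a" "Gamma ?b"] pos(1,2)[THEN less_imp_neq] by simp
  then have le: "(Gamma (3 / 2 + real n))\<^sup>2 \<le> Gamma ?a * Gamma ?b"
    using ln_le_cancel_iff[OF zero_less_power[OF pos(3)] mult_pos_pos[OF pos(1,2)]] by blast
  have "Gamma ?a = fact n" "Gamma ?b = fact (Suc n)"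
    using Gamma_fact[of n, where 'a = real] Gamma_fact[of "Suc n", where 'a = real] by (simp_all add: add_ac)
  with le have G: "(Gamma (3 / 2 + real n))\<^sup>2 \<le> ?a * (fact n)\<^sup>2"
    by (simp add: power2_eq_square algebra_simps)
  have "(1 / 2 :: real) \<notin> \<int>\<^sub>\<le>\<^sub>0"
  proof
    assume "(1 / 2 :: real) \<in> \<int>\<^sub>\<le>\<^sub>0"
    then obtain k where "(1 / 2 :: real) = of_int k" "k \<le> 0" by (rule nonpos_Ints_cases)
    then show False using of_int_le_0_iff[of k, where 'a = real] by linarith
  qed
  then have G32: "Gamma (3 / 2 :: real) = sqrt pi / 2"
    using Gamma_plus1[of "1 / 2 :: real"] by (simp add: Gamma_one_half_real)
  have "bergman_weight n = Gamma (3 / 2 + real n) / (sqrt pi / 2) / fact n"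
    unfolding bergman_weight_def by (subst pochhammer_Gamma) (auto simp: G32)
  then have "(bergman_weight n)\<^sup>2 = 4 / pi * ((Gamma (3 / 2 + real n))\<^sup>2 / (fact n)\<^sup>2)"
    by (simp add: power_divide power_mult_distrib)
  also have "\<dots> \<le> 4 / pi * ?a"
    using G by (intro mult_left_mono) (simp_all add: divide_le_eq)
  finally show ?thesis .
qed

text \<open>The monomials are orthogonal on the disc and z^i has squared norm pi / (i + 1); this is
  the decay that compensates the growth of the squared \<open>bergman_weight\<close>.\<close>

lemma nn_integral_disc_polynomial:
  "(\<integral>\<^sup>+ z. indicator (ball 0 1) z * ennreal ((cmod (\<Sum>i<N. a i * z ^ i))\<^sup>2) \<partial>lborel)
    = ennreal (pi * (\<Sum>i<N. (cmod (a i))\<^sup>2 / (real i + 1)))"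
proof -
  let ?p = "\<lambda>z. \<Sum>i<N. a i * z ^ i"
  have int: "set_integrable lborel (ball 0 1) (\<lambda>z. (cmod (?p z))\<^sup>2)"
    by (intro set_integrable_ball_continuous continuous_intros)
  have intm: "set_integrable lborel (ball 0 1) (\<lambda>z. z ^ i * cnj z ^ j)" for i j
    by (intro set_integrable_ball_continuous continuous_intros)
  have "complex_of_real (LINT z:ball 0 1|lborel. (cmod (?p z))\<^sup>2)
      = (LINT z:ball 0 1|lborel. complex_of_real ((cmod (?p z))\<^sup>2))"
    by (rule set_integral_complex_of_real[symmetric])
  also have "\<dots> = (LINT z:ball 0 1|lborel. (\<Sum>i<N. \<Sum>j<N. (a i * cnj (a j)) * (z ^ i * cnj z ^ j)))"
    by (simp only: complex_norm_square cnj_sum sum_product complex_cnj_mult complex_cnj_power) (simp add: mult_ac)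
  also have "\<dots> = (\<Sum>i<N. \<Sum>j<N. LINT z:ball 0 1|lborel. (a i * cnj (a j)) * (z ^ i * cnj z ^ j))"
    using set_integrable_mult_right[OF intm]
    unfolding set_lebesgue_integral_def set_integrable_def scaleR_sum_right
    by (simp only: Bochner_Integration.integral_sum Bochner_Integration.integrable_sum simp_thms)
  also have "\<dots> = (\<Sum>i<N. \<Sum>j<N. if i = j then of_real (pi * ((cmod (a i))\<^sup>2 / (real i + 1))) else 0)"
    by (intro sum.cong refl) (auto simp: ball_moment complex_norm_square mult_ac simp del: of_real_power)
  also have "\<dots> = of_real (pi * (\<Sum>i<N. (cmod (a i))\<^sup>2 / (real i + 1)))"
    by (simp add: sum_distrib_left)
  finally have eq: "(LINT z:ball 0 1|lborel. (cmod (?p z))\<^sup>2) = pi * (\<Sum>i<N. (cmod (a i))\<^sup>2 / (real i + 1))"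
    using of_real_eq_iff by blast
  have "(\<integral>\<^sup>+ z. indicator (ball 0 1) z * ennreal ((cmod (?p z))\<^sup>2) \<partial>lborel)
      = (\<integral>\<^sup>+ z. ennreal (indicator (ball 0 1) z *\<^sub>R (cmod (?p z))\<^sup>2) \<partial>lborel)"
    by (intro nn_integral_cong) (simp add: indicator_def)
  also have "\<dots> = ennreal (LINT z:ball 0 1|lborel. (cmod (?p z))\<^sup>2)"
    using int unfolding set_lebesgue_integral_def set_integrable_def
    by (intro nn_integral_eq_integral) auto
  finally show ?thesis by (simp only: eq)
qed

text \<open>Grouping by i + j sums over triangles, a truncated matrix over squares. The square of
  size N lies between the triangles of sizes N and 2 N, so the difference is bounded by a stretch of
  an absolutely convergent series, which tends to zero.\<close>

lemma square_sums_tendsto: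
  fixes e :: "nat \<Rightarrow> complex" and w :: "nat \<Rightarrow> nat \<Rightarrow> real"
  assumes w: "\<And>i j. 0 \<le> w i j" and sm: "summable (\<lambda>n. (\<Sum>i\<le>n. w i (n - i)) * cmod (e n))"
  shows "(\<lambda>N. \<Sum>i<N. \<Sum>j<N. of_real (w i j) * e (i + j)) \<longlonglongrightarrow> (\<Sum>n. of_real (\<Sum>i\<le>n. w i (n - i)) * e n)"
proof -
  let ?f = "\<lambda>p. of_real (w (fst p) (snd p)) * e (fst p + snd p)"
  let ?T = "\<lambda>N. {(i, j). i + j < (N::nat)}" and ?Q = "\<lambda>N::nat. {..<N} \<times> {..<N}"
  define P where "P N = (\<Sum>n<N. (\<Sum>i\<le>n. w i (n - i)) * cmod (e n))" for N
  define p where "p N = (\<Sum>n<N. of_real (\<Sum>i\<le>n. w i (n - i)) * e n)" for N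
  have fin: "finite (?T N)" for N by (rule finite_subset[of _ "?Q N"]) auto
  have pT: "p N = sum ?f (?T N)" for N
    using sum.triangle_reindex[of "\<lambda>i j. ?f (i, j)" N]
    by (simp add: p_def sum_distrib_right split_def)
  have PT: "P N = (\<Sum>q\<in>?T N. cmod (?f q))" for N
    using sum.triangle_reindex[of "\<lambda>i j. cmod (?f (i, j))" N] w
    by (simp add: P_def sum_distrib_right split_def norm_mult)
  have close: "cmod ((\<Sum>i<N. \<Sum>j<N. of_real (w i j) * e (i + j)) - p N) \<le> P (2 * N) - P N" for N
  proof -
    have TQ: "?T N \<subseteq> ?Q N" "?Q N \<subseteq> ?T (2 * N)" "?T N \<subseteq> ?T (2 * N)" by auto
    have "(\<Sum>i<N. \<Sum>j<N. of_real (w i j) * e (i + j)) - p N = sum ?f (?Q N - ?T N)"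
      using TQ by (simp add: pT sum_diff sum.cartesian_product split_def)
    also have "cmod \<dots> \<le> (\<Sum>q\<in>?Q N - ?T N. cmod (?f q))" by (rule norm_sum)
    also have "\<dots> \<le> (\<Sum>q\<in>?T (2 * N) - ?T N. cmod (?f q))"
      using TQ fin by (intro sum_mono2) auto
    also have "\<dots> = P (2 * N) - P N" using TQ fin by (simp add: PT sum_diff)
    finally show ?thesis .
  qed
  have P: "P \<longlonglongrightarrow> (\<Sum>n. (\<Sum>i\<le>n. w i (n - i)) * cmod (e n))"
    unfolding P_def by (rule summable_LIMSEQ[OF sm])
  then have "(\<lambda>N. P (2 * N)) \<longlonglongrightarrow> (\<Sum>n. (\<Sum>i\<le>n. w i (n - i)) * cmod (e n))"
    by (rule LIMSEQ_subseq_LIMSEQ[unfolded comp_def]) (simp add: strict_mono_def)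
  from tendsto_diff[OF this P] have "(\<lambda>N. P (2 * N) - P N) \<longlonglongrightarrow> 0" by simp
  then have "(\<lambda>N. (\<Sum>i<N. \<Sum>j<N. of_real (w i j) * e (i + j)) - p N) \<longlonglongrightarrow> 0"
    by (rule Lim_null_comparison[rotated]) (simp add: close)
  moreover have "p \<longlonglongrightarrow> (\<Sum>n. of_real (\<Sum>i\<le>n. w i (n - i)) * e n)"
    unfolding p_def
  proof (rule summable_LIMSEQ, rule summable_norm_cancel)
    have "norm (of_real (\<Sum>i\<le>n. w i (n - i)) * e n) = (\<Sum>i\<le>n. w i (n - i)) * cmod (e n)" for n
      unfolding norm_mult norm_of_real by (simp add: w sum_nonneg)
    then show "summable (\<lambda>n. norm (of_real (\<Sum>i\<le>n. w i (n - i)) * e n))" using sm by simp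
  qed
  ultimately show ?thesis using tendsto_add by fastforce
qed

text \<open>The second derivative of the geometric series.\<close>

lemma summable_quadratic_power:
  assumes "\<bar>r\<bar> < (1::real)"
  shows "summable (\<lambda>n. real ((n + 2) * (n + 1)) * r ^ n)"
proof -
  have "summable (\<lambda>n. diffs (diffs (\<lambda>_. 1)) n * r ^ n)"
    by (rule termdiff_converges[of _ 1], use assms in simp)+ (auto intro: summable_geometric)
  then show ?thesis by (simp add: diffs_def algebra_simps)
qed

lemma disc_L1_norm_le_trace_norm:
  fixes c :: "nat \<Rightarrow> complex"
  assumes c: "\<And>n. cmod (c n) \<le> C"
  shows "disc_L1_norm (\<lambda>z. \<Sum>n. of_nat ((n + 2) * (n + 1)) * c n * z ^ n)
    \<le> ennreal (8 / pi) * trace_norm (\<lambda>i j. c (i + j))"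
proof -
  let ?H = "\<lambda>i j. c (i + j)"
  let ?g = "\<lambda>z. \<Sum>n. of_nat ((n + 2) * (n + 1)) * c n * z ^ n"
  \<comment> \<open>The factor 2 collects the two factors sqrt 2 of \<phi>, which
    \<open>bergman_weight\<close> leaves out.\<close>
  define G where "G N z = 2 * (\<Sum>i<N. \<Sum>j<N. of_real (bergman_weight i * bergman_weight j) * (c (i + j) * z ^ (i + j)))" for N z
  have [measurable]: "ball (0::complex) 1 \<in> sets borel" by simp
  have [measurable]: "G N \<in> borel_measurable borel" for N
    unfolding G_def by (intro borel_measurable_continuous_onI continuous_intros)
  have lim: "(\<lambda>N. G N z) \<longlonglongrightarrow> ?g z" if z: "cmod z < 1" for z
  proof -
    have hw2: "complex_of_real (\<Sum>i\<le>n. bergman_weight i * bergman_weight (n - i)) = of_nat ((n + 2) * (n + 1)) / 2" for n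
      unfolding bergman_weight_convolution by (simp add: algebra_simps)
    have "summable (\<lambda>n. (\<Sum>i\<le>n. bergman_weight i * bergman_weight (n - i)) * cmod (c n * z ^ n))"
    proof (rule summable_comparison_test)
      show "summable (\<lambda>n. C / 2 * (real ((n + 2) * (n + 1)) * cmod z ^ n))"
        using z by (intro summable_mult summable_quadratic_power) simp
      have "(\<Sum>i\<le>n. bergman_weight i * bergman_weight (n - i)) * cmod (c n * z ^ n) \<le> (real n + 1) * (real n + 2) / 2 * (C * cmod z ^ n)" for n
        unfolding bergman_weight_convolution norm_mult norm_power by (intro mult_left_mono mult_right_mono c) auto
      moreover have "(real n + 1) * (real n + 2) / 2 * (C * cmod z ^ n) = C / 2 * (real ((n + 2) * (n + 1)) * cmod z ^ n)" for n
        by (simp add: algebra_simps)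
      moreover have "norm ((\<Sum>i\<le>n. bergman_weight i * bergman_weight (n - i)) * cmod (c n * z ^ n)) = (\<Sum>i\<le>n. bergman_weight i * bergman_weight (n - i)) * cmod (c n * z ^ n)" for n
        by (simp add: sum_nonneg)
      ultimately show "\<exists>N. \<forall>n\<ge>N. norm ((\<Sum>i\<le>n. bergman_weight i * bergman_weight (n - i)) * cmod (c n * z ^ n)) \<le> C / 2 * (real ((n + 2) * (n + 1)) * cmod z ^ n)"
        by metis
    qed
    then have "(\<lambda>N. \<Sum>i<N. \<Sum>j<N. of_real (bergman_weight i * bergman_weight j) * (c (i + j) * z ^ (i + j)))
        \<longlonglongrightarrow> (\<Sum>n. of_real (\<Sum>i\<le>n. bergman_weight i * bergman_weight (n - i)) * (c n * z ^ n))"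
      by (intro square_sums_tendsto) auto
    from tendsto_mult_left[OF this, of 2] have "(\<lambda>N. G N z) \<longlonglongrightarrow> 2 * (\<Sum>n. of_nat ((n + 2) * (n + 1)) / 2 * (c n * z ^ n))"
      by (simp only: G_def hw2)
    also have "2 * (\<Sum>n. of_nat ((n + 2) * (n + 1)) / 2 * (c n * z ^ n)) = ?g z"
    proof (subst suminf_mult[symmetric])
      have "summable (\<lambda>n. of_real (\<Sum>i\<le>n. bergman_weight i * bergman_weight (n - i)) * (c n * z ^ n))"
      proof (rule summable_norm_cancel)
        have "norm (of_real (\<Sum>i\<le>n. bergman_weight i * bergman_weight (n - i)) * (c n * z ^ n)) = (\<Sum>i\<le>n. bergman_weight i * bergman_weight (n - i)) * cmod (c n * z ^ n)" for n
          unfolding norm_mult[of "of_real _"] norm_of_real by (simp add: sum_nonneg)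
        then show "summable (\<lambda>n. norm (of_real (\<Sum>i\<le>n. bergman_weight i * bergman_weight (n - i)) * (c n * z ^ n)))"
          using \<open>summable _\<close> by (simp only:)
      qed
      then show "summable (\<lambda>n. of_nat ((n + 2) * (n + 1)) / 2 * (c n * z ^ n))" by (simp only: hw2)
    qed (simp add: mult.assoc)
    finally show ?thesis .
  qed
  have bound: "(\<integral>\<^sup>+ z. indicator (ball 0 1) z * ennreal (cmod (G N z)) \<partial>lborel) \<le> 8 * trace_norm ?H" for N
  proof -
    obtain \<sigma> x y where "deflation N ?H \<sigma> x y" by (rule deflation_exists)
    then interpret deflation N ?H \<sigma> x y .
    let ?f = "\<lambda>l z. \<Sum>i<N. (of_real (bergman_weight i) * y l i) * z ^ i"
    let ?h = "\<lambda>l z. \<Sum>i<N. (of_real (bergman_weight i) * cnj (x l i)) * z ^ i"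
    have "G N z = 2 * (\<Sum>l<N. of_real (\<sigma> l) * (?f l z * ?h l z))" for z
    proof -
      have "(\<Sum>i<N. \<Sum>j<N. of_real (bergman_weight i * bergman_weight j) * (c (i + j) * z ^ (i + j)))
         = (\<Sum>i<N. \<Sum>j<N. \<Sum>l<N. of_real (\<sigma> l) * ((of_real (bergman_weight i) * y l i * z ^ i) * (of_real (bergman_weight j) * cnj (x l j) * z ^ j)))"
      proof (intro sum.cong refl)
        fix i j assume "i \<in> {..<N}" "j \<in> {..<N}"
        then have "c (i + j) = (\<Sum>l<N. of_real (\<sigma> l) * y l i * cnj (x l j))" by (intro expansion) auto
        then show "of_real (bergman_weight i * bergman_weight j) * (c (i + j) * z ^ (i + j)) =
            (\<Sum>l<N. of_real (\<sigma> l) * ((of_real (bergman_weight i) * y l i * z ^ i) * (of_real (bergman_weight j) * cnj (x l j) * z ^ j)))"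
          by (simp add: sum_distrib_left sum_distrib_right power_add mult_ac)
      qed
      also have "\<dots> = (\<Sum>l<N. \<Sum>i<N. \<Sum>j<N. of_real (\<sigma> l) * ((of_real (bergman_weight i) * y l i * z ^ i) * (of_real (bergman_weight j) * cnj (x l j) * z ^ j)))"
        by (subst sum.swap, rule sum.cong[OF refl], subst sum.swap) (rule refl)
      also have "\<dots> = (\<Sum>l<N. of_real (\<sigma> l) * (?f l z * ?h l z))"
        by (simp only: sum_product[of "\<lambda>i. of_real (bergman_weight i) * y _ i * z ^ i"], simp only: sum_distrib_left)
      finally show ?thesis by (simp add: G_def)
    qed
    \<comment> \<open>Since 2 |f h| \<le> |f|^2 + |h|^2, the products reduce to squares, whose
      integrals are explicit.\<close>
    then have G: "cmod (G N z) \<le> (\<Sum>l<N. \<sigma> l * ((cmod (?f l z))\<^sup>2 + (cmod (?h l z))\<^sup>2))" for z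
    proof -
      assume "\<And>z. G N z = 2 * (\<Sum>l<N. of_real (\<sigma> l) * (?f l z * ?h l z))"
      then have "cmod (G N z) \<le> 2 * (\<Sum>l<N. cmod (of_real (\<sigma> l) * (?f l z * ?h l z)))"
        by (simp only: norm_mult[of 2] norm_numeral) (intro mult_left_mono norm_sum, simp)
      also have "\<dots> = (\<Sum>l<N. \<sigma> l * (2 * cmod (?f l z) * cmod (?h l z)))"
      proof -
        have "2 * cmod (of_real (\<sigma> l) * (a * b)) = \<sigma> l * (2 * cmod a * cmod b)" for l a b
          by (simp add: norm_mult \<sigma>_nonneg)
        then show ?thesis by (subst sum_distrib_left) (simp only:)
      qed
      also have "\<dots> \<le> (\<Sum>l<N. \<sigma> l * ((cmod (?f l z))\<^sup>2 + (cmod (?h l z))\<^sup>2))"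
        by (intro sum_mono mult_left_mono sum_squares_bound \<sigma>_nonneg)
      finally show ?thesis .
    qed
    have [measurable]: "?f l \<in> borel_measurable borel" "?h l \<in> borel_measurable borel" for l
      by (intro borel_measurable_continuous_onI continuous_intros)+
    \<comment> \<open>The bound 4 is pi times the constant 4 / pi of the weight estimate. The two
      factors of each product together give 8.\<close>
    have poly: "(\<integral>\<^sup>+ z. indicator (ball 0 1) z * ennreal ((cmod (\<Sum>i<N. (of_real (bergman_weight i) * a i) * z ^ i))\<^sup>2) \<partial>lborel) \<le> 4"
      if a: "nsq N a \<le> 1" for a
    proof -
      have "(\<Sum>i<N. (cmod (of_real (bergman_weight i) * a i))\<^sup>2 / (real i + 1)) \<le> (\<Sum>i<N. 4 / pi * (cmod (a i))\<^sup>2)"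
      proof (rule sum_mono)
        fix i
        have "(bergman_weight i)\<^sup>2 * (cmod (a i))\<^sup>2 \<le> (4 / pi * (real i + 1)) * (cmod (a i))\<^sup>2"
          by (intro mult_right_mono bergman_weight_square_le) simp
        then show "(cmod (of_real (bergman_weight i) * a i))\<^sup>2 / (real i + 1) \<le> 4 / pi * (cmod (a i))\<^sup>2"
          by (simp add: norm_mult power_mult_distrib divide_le_eq algebra_simps)
      qed
      also have "\<dots> = 4 / pi * nsq N a" by (simp add: nsq_def sum_distrib_left)
      also have "\<dots> \<le> 4 / pi * 1" using a by (intro mult_left_mono) auto
      finally have "pi * (\<Sum>i<N. (cmod (of_real (bergman_weight i) * a i))\<^sup>2 / (real i + 1)) \<le> 4"
        by (simp add: field_simps)
      then show ?thesis unfolding nn_integral_disc_polynomial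
        using ennreal_leI by fastforce
    qed
    have nc: "nsq N (\<lambda>i. cnj (x l i)) \<le> 1" for l using nsq_le_1[of l] by (simp add: nsq_def)
    have "(\<integral>\<^sup>+ z. indicator (ball 0 1) z * ennreal (cmod (G N z)) \<partial>lborel)
      \<le> (\<integral>\<^sup>+ z. (\<Sum>l<N. ennreal (\<sigma> l) * (indicator (ball 0 1) z * ennreal ((cmod (?f l z))\<^sup>2) + indicator (ball 0 1) z * ennreal ((cmod (?h l z))\<^sup>2))) \<partial>lborel)"
    proof (rule nn_integral_mono)
      fix z
      show "indicator (ball 0 1) z * ennreal (cmod (G N z)) \<le> (\<Sum>l<N. ennreal (\<sigma> l) * (indicator (ball 0 1) z * ennreal ((cmod (?f l z))\<^sup>2) + indicator (ball 0 1) z * ennreal ((cmod (?h l z))\<^sup>2)))"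
      proof (cases "z \<in> ball 0 1")
        case True
        have "ennreal (cmod (G N z)) \<le> ennreal (\<Sum>l<N. \<sigma> l * ((cmod (?f l z))\<^sup>2 + (cmod (?h l z))\<^sup>2))"
          by (rule ennreal_leI[OF G])
        also have "\<dots> = (\<Sum>l<N. ennreal (\<sigma> l) * (ennreal ((cmod (?f l z))\<^sup>2) + ennreal ((cmod (?h l z))\<^sup>2)))"
          by (subst sum_ennreal[symmetric]) (auto simp: \<sigma>_nonneg ennreal_mult ennreal_plus)
        finally show ?thesis using True by simp
      qed simp
    qed
    also have "\<dots> = (\<Sum>l<N. ennreal (\<sigma> l) * ((\<integral>\<^sup>+ z. indicator (ball 0 1) z * ennreal ((cmod (?f l z))\<^sup>2) \<partial>lborel) + (\<integral>\<^sup>+ z. indicator (ball 0 1) z * ennreal ((cmod (?h l z))\<^sup>2) \<partial>lborel)))"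
      by (simp add: nn_integral_sum nn_integral_cmult nn_integral_add)
    also have "\<dots> \<le> (\<Sum>l<N. sing_num ?H l * (4 + 4))"
      by (intro sum_mono mult_mono add_mono poly singular_le_sing_num nsq_le_1 nc) auto
    also have "\<dots> = 8 * (\<Sum>l<N. sing_num ?H l)" by (simp add: sum_distrib_left mult.commute)
    also have "\<dots> \<le> 8 * trace_norm ?H"
      unfolding trace_norm_def by (intro mult_left_mono sum_le_suminf) auto
    finally show ?thesis .
  qed
  have "(\<integral>\<^sup>+ z. indicator (ball 0 1) z * ennreal (cmod (?g z)) \<partial>lborel)
      = (\<integral>\<^sup>+ z. liminf (\<lambda>N. indicator (ball 0 1) z * ennreal (cmod (G N z))) \<partial>lborel)"
  proof (rule nn_integral_cong)
    fix z
    have "(\<lambda>N. indicator (ball 0 1) z * ennreal (cmod (G N z))) \<longlonglongrightarrow> indicator (ball 0 1) z * ennreal (cmod (?g z))"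
    proof (cases "z \<in> ball 0 1")
      case True
      then have "(\<lambda>N. G N z) \<longlonglongrightarrow> ?g z" by (intro lim) simp
      with True show ?thesis by (simp only: indicator_simps mult_1_left) (intro tendsto_ennrealI tendsto_norm)
    qed simp
    then show "indicator (ball 0 1) z * ennreal (cmod (?g z)) = liminf (\<lambda>N. indicator (ball 0 1) z * ennreal (cmod (G N z)))"
      by (intro lim_imp_Liminf[symmetric]) auto
  qed
  also have "\<dots> \<le> liminf (\<lambda>N. \<integral>\<^sup>+ z. indicator (ball 0 1) z * ennreal (cmod (G N z)) \<partial>lborel)"
    by (rule nn_integral_liminf) measurable
  also have "\<dots> \<le> liminf (\<lambda>N. 8 * trace_norm ?H)"
    by (intro Liminf_mono always_eventually allI bound)
  also have "\<dots> = 8 * trace_norm ?H" by (simp add: Liminf_const)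
  finally have "disc_L1_norm ?g \<le> ennreal (1 / pi) * (8 * trace_norm ?H)"
    unfolding disc_L1_norm_def by (intro mult_left_mono) auto
  also have "\<dots> = ennreal (8 / pi) * trace_norm ?H"
    using ennreal_mult[of "1 / pi" 8] by (simp add: mult.assoc[symmetric])
  finally show ?thesis .
qed

subsection \<open>The integral formula\<close>

text \<open>At r = 1 the diagonal value is pi / ((m + 1) (m + 2)), which cancels the factor in the
  coefficients of g. Smaller radii serve the termwise integration of the series.\<close>

lemma ball_weighted_moment:
  assumes "r > 0"
  shows "(LINT z:ball 0 r|lborel. cnj z ^ n * z ^ m * of_real (1 - (cmod z)\<^sup>2)) =
    (if m = n then of_real (pi * (r ^ (2 * m + 2) / (m + 1) - r ^ (2 * m + 4) / (m + 2))) else 0)"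
proof -
  have int: "set_integrable lborel (ball 0 r) (\<lambda>z. z ^ i * cnj z ^ j)" for i j
    by (intro set_integrable_ball_continuous continuous_intros)
  have eq: "cnj z ^ n * z ^ m * of_real (1 - (cmod z)\<^sup>2) = z ^ m * cnj z ^ n - z ^ Suc m * cnj z ^ Suc n" for z
    by (simp only: of_real_diff of_real_1 complex_norm_square power_Suc) (simp add: algebra_simps)
  have "(LINT z:ball 0 r|lborel. cnj z ^ n * z ^ m * of_real (1 - (cmod z)\<^sup>2))
      = (LINT z:ball 0 r|lborel. z ^ m * cnj z ^ n) - (LINT z:ball 0 r|lborel. z ^ Suc m * cnj z ^ Suc n)"
    unfolding eq by (rule set_integral_diff[OF int int])
  also have "\<dots> = (if m = n then of_real (pi * (r ^ (2 * m + 2) / (m + 1) - r ^ (2 * m + 4) / (m + 2))) else 0)"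
  proof -
    have e: "2 * Suc n + 2 = 2 * n + 4" "Suc n + 1 = n + 2" for n :: nat by simp_all
    show ?thesis unfolding ball_moment[OF assms] e by (auto simp: right_diff_distrib)
  qed
  finally show ?thesis .
qed

lemma set_integrable_disc_cnj:
  assumes "set_integrable lborel (ball 0 1) g"
  shows "set_integrable lborel (ball 0 1) (\<lambda>z::complex. g (cnj z) :: complex)"
proof -
  have [measurable]: "cnj \<in> borel_measurable borel"
    by (intro borel_measurable_continuous_onI continuous_intros)
  have "integrable (distr lborel borel cnj) (\<lambda>z. indicator (ball 0 1) z *\<^sub>R g z)"
    using assms by (simp add: lborel_distr_cnj set_integrable_def)
  then have "integrable lborel (\<lambda>z. indicator (ball 0 1) (cnj z) *\<^sub>R g (cnj z))"
    by (rule integrable_distr[rotated]) simp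
  then show ?thesis by (simp add: set_integrable_def indicator_def)
qed

text \<open>Integrability of g does not by itself control the partial sums of its power series near
  the boundary. The series is therefore integrated termwise on smaller discs, where its terms have a
  summable bound, and the radius then tends to 1 with |g| of the conjugate as dominating
  function.\<close>

lemma coefficient_integral:
  fixes c :: "nat \<Rightarrow> complex"
  defines "g \<equiv> (\<lambda>z. \<Sum>n. of_nat ((n + 2) * (n + 1)) * c n * z ^ n)"
  assumes c: "\<And>n. cmod (c n) \<le> C" and int: "set_integrable lborel (ball 0 1) g"
  shows "(LINT z:ball 0 1|lborel. g (cnj z) * z ^ m * of_real (1 - (cmod z)\<^sup>2)) = of_real pi * c m"
proof -
  have [measurable]: "ball (0::complex) r \<in> sets borel" for r by simp
  let ?a = "\<lambda>n. of_nat ((n + 2) * (n + 1)) * c n"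
  let ?b = "\<lambda>r. ?a m * of_real (pi * (r ^ (2 * m + 2) / (m + 1) - r ^ (2 * m + 4) / (m + 2)))"
  have small: "(LINT z:ball 0 r|lborel. g (cnj z) * z ^ m * of_real (1 - (cmod z)\<^sup>2)) = ?b r"
    if r: "0 < r" "r < 1" for r
  proof -
    define s where "s N z = indicator (ball 0 r) z *\<^sub>R ((\<Sum>n<N. ?a n * cnj z ^ n) * z ^ m * of_real (1 - (cmod z)\<^sup>2))" for N z
    define K where "K = (\<Sum>n. C * (real ((n + 2) * (n + 1)) * r ^ n))"
    have smr: "summable (\<lambda>n. C * (real ((n + 2) * (n + 1)) * r ^ n))"
      using r by (intro summable_mult summable_quadratic_power) simp
    have C: "0 \<le> C" using c[of 0] norm_ge_zero order_trans by blast
    have term_le: "cmod (?a n * z ^ n) \<le> C * (real ((n + 2) * (n + 1)) * r ^ n)" if "cmod z \<le> r" for z n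
    proof -
      have "cmod (?a n * z ^ n) = real ((n + 2) * (n + 1)) * (cmod (c n) * cmod z ^ n)"
        by (simp only: norm_mult norm_of_nat norm_power mult.assoc)
      also have "\<dots> \<le> real ((n + 2) * (n + 1)) * (C * r ^ n)"
        using that C by (intro mult_left_mono mult_mono power_mono c) auto
      finally show ?thesis by (simp only: mult_ac)
    qed
    have "(\<lambda>N. integral\<^sup>L lborel (s N)) \<longlonglongrightarrow> (LINT z|lborel. indicator (ball 0 r) z *\<^sub>R (g (cnj z) * z ^ m * of_real (1 - (cmod z)\<^sup>2)))"
    proof (rule integral_dominated_convergence[where w = "\<lambda>z. indicator (ball 0 r) z *\<^sub>R K"])
      have conv: "(\<lambda>N. s N z) \<longlonglongrightarrow> indicator (ball 0 r) z *\<^sub>R (g (cnj z) * z ^ m * of_real (1 - (cmod z)\<^sup>2))" for z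
      proof (cases "z \<in> ball 0 r")
        case True
        then have "summable (\<lambda>n. ?a n * cnj z ^ n)"
          by (intro summable_comparison_test[OF _ smr] exI[of _ 0] allI impI term_le) auto
        from summable_LIMSEQ[OF this] show ?thesis unfolding s_def g_def
          by (intro tendsto_intros)
      qed (simp add: s_def)
      then show "AE z in lborel. (\<lambda>N. s N z) \<longlonglongrightarrow> indicator (ball 0 r) z *\<^sub>R (g (cnj z) * z ^ m * of_real (1 - (cmod z)\<^sup>2))"
        by simp
      show ms: "s N \<in> borel_measurable lborel" for N
        unfolding s_def measurable_lborel2
        by (intro borel_measurable_scaleR borel_measurable_indicator borel_measurable_continuous_onI continuous_intros) simp
      show "(\<lambda>z. indicator (ball 0 r) z *\<^sub>R (g (cnj z) * z ^ m * of_real (1 - (cmod z)\<^sup>2))) \<in> borel_measurable lborel"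
        by (rule borel_measurable_LIMSEQ_metric[OF ms conv])
      show "integrable lborel (\<lambda>z::complex. indicator (ball 0 r) z *\<^sub>R K)"
        using set_integrable_ball_continuous[of "\<lambda>_. K" r] by (simp add: set_integrable_def)
      show "AE z in lborel. norm (s N z) \<le> indicator (ball 0 r) z *\<^sub>R K" for N
      proof (rule AE_I2)
        fix z
        show "norm (s N z) \<le> indicator (ball 0 r) z *\<^sub>R K"
        proof (cases "z \<in> ball 0 r")
          case True
          then have z: "cmod z \<le> r" "cmod z \<le> 1" using r by auto
          have "cmod (\<Sum>n<N. ?a n * cnj z ^ n) \<le> (\<Sum>n<N. C * (real ((n + 2) * (n + 1)) * r ^ n))"
            using z by (intro order_trans[OF norm_sum] sum_mono term_le) simp
          also have "\<dots> \<le> K" unfolding K_def using r C by (intro sum_le_suminf smr) auto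
          finally have 1: "cmod (\<Sum>n<N. ?a n * cnj z ^ n) \<le> K" .
          then have K: "0 \<le> K" by (rule order_trans[OF norm_ge_zero])
          have 2: "cmod z ^ m * (1 - (cmod z)\<^sup>2) \<le> 1" "0 \<le> 1 - (cmod z)\<^sup>2"
            using z by (auto intro!: mult_le_one power_le_one)
          have "norm (s N z) = cmod (\<Sum>n<N. ?a n * cnj z ^ n) * (cmod z ^ m * (1 - (cmod z)\<^sup>2))"
            using True 2(2) unfolding s_def by (simp only: norm_scaleR norm_mult norm_power norm_of_real abs_of_nonneg mult.assoc) simp
          also have "\<dots> \<le> K * 1" using 1 2 K by (intro mult_mono) auto
          finally show ?thesis using True by simp
        qed (simp add: s_def)
      qed
    qed
    \<comment> \<open>By orthogonality only the term n = m survives, so the sequence is constant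
      once N > m.\<close>
    moreover have "integral\<^sup>L lborel (s N) = ?b r" if "N > m" for N
    proof -
      have i: "set_integrable lborel (ball 0 r) (\<lambda>z. ?a n * (cnj z ^ n * z ^ m * of_real (1 - (cmod z)\<^sup>2)))" for n
        by (intro set_integrable_ball_continuous continuous_intros)
      have "integral\<^sup>L lborel (s N) = (LINT z|lborel. (\<Sum>n<N. indicator (ball 0 r) z *\<^sub>R (?a n * (cnj z ^ n * z ^ m * of_real (1 - (cmod z)\<^sup>2)))))"
        unfolding s_def by (simp only: scaleR_sum_right[symmetric] sum_distrib_right mult.assoc)
      also have "\<dots> = (\<Sum>n<N. LINT z:ball 0 r|lborel. ?a n * (cnj z ^ n * z ^ m * of_real (1 - (cmod z)\<^sup>2)))"
        using i unfolding set_lebesgue_integral_def set_integrable_def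
        by (intro Bochner_Integration.integral_sum)
      also have "\<dots> = (\<Sum>n<N. if n = m then ?b r else 0)"
        unfolding set_integral_mult_right ball_weighted_moment[OF r(1)] by (intro sum.cong) auto
      also have "\<dots> = ?b r" using that by simp
      finally show ?thesis .
    qed
    then have "(\<lambda>N. integral\<^sup>L lborel (s N)) \<longlonglongrightarrow> ?b r"
      by (intro tendsto_eventually eventually_at_top_linorderI[of "Suc m"]) auto
    ultimately show ?thesis unfolding set_lebesgue_integral_def by (rule LIMSEQ_unique)
  qed
  \<comment> \<open>The double successor makes the first radius 1/2, so that all radii are
    positive.\<close>
  define \<rho> where "\<rho> k = 1 - inverse (real (Suc (Suc k)))" for k
  have \<rho>: "0 < \<rho> k" "\<rho> k < 1" for k by (auto simp: \<rho>_def field_simps)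
  have \<rho>1: "\<rho> \<longlonglongrightarrow> 1"
    unfolding \<rho>_def using tendsto_diff[OF tendsto_const LIMSEQ_Suc[OF LIMSEQ_inverse_real_of_nat], of 1] by simp
  let ?F = "\<lambda>z. indicator (ball 0 1) z *\<^sub>R (g (cnj z) * z ^ m * of_real (1 - (cmod z)\<^sup>2))"
  have gc: "integrable lborel (\<lambda>z. indicator (ball 0 1) z *\<^sub>R g (cnj z))"
    using set_integrable_disc_cnj[OF int] by (simp add: set_integrable_def)
  have meas: "?F \<in> borel_measurable lborel"
  proof -
    have "(\<lambda>z. (indicator (ball 0 1) z *\<^sub>R g (cnj z)) * (z ^ m * of_real (1 - (cmod z)\<^sup>2))) \<in> borel_measurable lborel"
      by (intro borel_measurable_times[OF borel_measurable_integrable[OF gc]])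
        (unfold measurable_lborel2, intro borel_measurable_continuous_onI continuous_intros)
    then show ?thesis by (simp add: mult.assoc)
  qed
  have lim: "(\<lambda>k. LINT z|lborel. indicator (ball 0 (\<rho> k)) z *\<^sub>R ?F z) \<longlonglongrightarrow> (LINT z|lborel. ?F z)"
  proof (rule integral_dominated_convergence[where w = "\<lambda>z. norm (indicator (ball 0 1) z *\<^sub>R g (cnj z))"])
    show "AE z in lborel. (\<lambda>k. indicator (ball 0 (\<rho> k)) z *\<^sub>R ?F z) \<longlonglongrightarrow> ?F z"
    proof (rule AE_I2)
      fix z
      show "(\<lambda>k. indicator (ball 0 (\<rho> k)) z *\<^sub>R ?F z) \<longlonglongrightarrow> ?F z"
      proof (cases "z \<in> ball 0 1")
        case True
        then have "eventually (\<lambda>k. cmod z < \<rho> k) sequentially"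
          using order_tendstoD(1)[OF \<rho>1] by simp
        then show ?thesis
          by (intro tendsto_eventually) (auto elim!: eventually_mono)
      qed simp
    qed
    show "AE z in lborel. norm (indicator (ball 0 (\<rho> k)) z *\<^sub>R ?F z) \<le> norm (indicator (ball 0 1) z *\<^sub>R g (cnj z))" for k
    proof (rule AE_I2)
      fix z
      show "norm (indicator (ball 0 (\<rho> k)) z *\<^sub>R ?F z) \<le> norm (indicator (ball 0 1) z *\<^sub>R g (cnj z))"
      proof (cases "z \<in> ball 0 1")
        case True
        then have 2: "cmod z ^ m * (1 - (cmod z)\<^sup>2) \<le> 1" "0 \<le> 1 - (cmod z)\<^sup>2"
          by (auto intro!: mult_le_one power_le_one)
        have "norm (?F z) = cmod (g (cnj z)) * (cmod z ^ m * (1 - (cmod z)\<^sup>2))"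
          using True 2(2) by (simp only: norm_scaleR norm_mult norm_power norm_of_real abs_of_nonneg mult.assoc) simp
        also have "\<dots> \<le> cmod (g (cnj z)) * 1" using 2 by (intro mult_left_mono) auto
        finally have "norm (?F z) \<le> cmod (g (cnj z))" by simp
        then show ?thesis using True by (auto simp: indicator_def)
      qed simp
    qed
    show "integrable lborel (\<lambda>z. norm (indicator (ball 0 1) z *\<^sub>R g (cnj z)))"
      by (rule integrable_norm[OF gc])
    show "(\<lambda>z. indicator (ball 0 (\<rho> k)) z *\<^sub>R ?F z) \<in> borel_measurable lborel" for k
      by (intro borel_measurable_scaleR borel_measurable_indicator meas) simp
  qed (rule meas)
  have eq: "(LINT z|lborel. indicator (ball 0 (\<rho> k)) z *\<^sub>R ?F z) = ?b (\<rho> k)" for k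
  proof -
    have "(LINT z|lborel. indicator (ball 0 (\<rho> k)) z *\<^sub>R ?F z) = (LINT z:ball 0 (\<rho> k)|lborel. g (cnj z) * z ^ m * of_real (1 - (cmod z)\<^sup>2))"
      unfolding set_lebesgue_integral_def using \<rho>(2)[of k]
      by (intro Bochner_Integration.integral_cong) (auto simp: indicator_def)
    then show ?thesis using small[OF \<rho>] by simp
  qed
  have lim_b: "(\<lambda>k. ?b (\<rho> k)) \<longlonglongrightarrow> ?b 1"
    by (intro tendsto_intros \<rho>1) auto
  have b1: "?b 1 = of_real pi * c m"
  proof -
    have "A * B * (1 / B - 1 / A) = 1" if "A = B + 1" "B > 0" for A B :: real
      using that add_pos_pos[OF that(2) mult_pos_pos[OF that(2,2)]] by (simp add: field_simps)
    from this[of "real (m + 2)" "real (m + 1)"]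
    have "real ((m + 2) * (m + 1)) * (1 / real (m + 1) - 1 / real (m + 2)) = 1"
      by (simp only: of_nat_mult) simp
    then have "complex_of_real (real ((m + 2) * (m + 1)) * (1 / real (m + 1) - 1 / real (m + 2))) = 1"
      by (simp only: of_real_1)
    moreover have "?b 1 = complex_of_real (real ((m + 2) * (m + 1)) * (1 / real (m + 1) - 1 / real (m + 2))) * (of_real pi * c m)"
      by (simp only: of_real_mult of_real_of_nat_eq power_one mult_ac)
    ultimately show ?thesis by simp
  qed
  have "(LINT z|lborel. ?F z) = of_real pi * c m"
    using LIMSEQ_unique[OF lim[unfolded eq] lim_b] b1 by (rule trans)
  then show ?thesis by (simp add: set_lebesgue_integral_def)
qed

subsection \<open>The trace norm bounded by the Bergman norm\<close>

lemma mat_norm_add: "mat_norm (\<lambda>i j. A i j + B i j) \<le> mat_norm A + mat_norm B"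
  unfolding mat_norm_def
proof (rule SUP_least, clarify)
  fix N :: nat and x y :: "nat \<Rightarrow> complex"
  assume xy: "(\<Sum>j<N. (cmod (x j))\<^sup>2) \<le> 1" "(\<Sum>i<N. (cmod (y i))\<^sup>2) \<le> 1"
  let ?f = "\<lambda>A. \<Sum>i<N. \<Sum>j<N. cnj (y i) * A i j * x j"
  have *: "ennreal (cmod (?f A)) \<le> mat_norm A" for A
    unfolding mat_norm_def by (rule SUP_upper2[of "(N, x, y)"]) (use xy in auto)
  have "?f (\<lambda>i j. A i j + B i j) = ?f A + ?f B"
    by (simp add: distrib_left distrib_right sum.distrib)
  then have "ennreal (cmod (?f (\<lambda>i j. A i j + B i j))) \<le> ennreal (cmod (?f A)) + ennreal (cmod (?f B))"
    by (simp add: ennreal_leI norm_triangle_ineq flip: ennreal_plus)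
  also have "\<dots> \<le> mat_norm A + mat_norm B" by (intro add_mono *)
  finally show "ennreal (cmod (?f (\<lambda>i j. A i j + B i j))) \<le>
    (SUP p\<in>{(N, x, y). (\<Sum>j<N. (cmod (x j))\<^sup>2) \<le> 1 \<and> (\<Sum>i<N. (cmod (y i))\<^sup>2) \<le> 1}.
      case p of (N, x, y) \<Rightarrow> ennreal (cmod (\<Sum>i<N. \<Sum>j<N. cnj (y i) * A i j * x j))) +
    (SUP p\<in>{(N, x, y). (\<Sum>j<N. (cmod (x j))\<^sup>2) \<le> 1 \<and> (\<Sum>i<N. (cmod (y i))\<^sup>2) \<le> 1}.
      case p of (N, x, y) \<Rightarrow> ennreal (cmod (\<Sum>i<N. \<Sum>j<N. cnj (y i) * B i j * x j)))"
    by (simp only: mat_norm_def)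
qed

lemma finite_support_ell2: "(\<And>i. N \<le> i \<Longrightarrow> x i = 0) \<Longrightarrow> x \<in> ell2"
  unfolding ell2_def by (auto intro!: summable_finite[of "{..<N}"] simp: not_le[symmetric])

text \<open>Cauchy-Schwarz against the geometric tail |z|^(2 N) / (1 - |z|^2), multiplied out. With
  \<open>N\<close> = 0 it bounds a full sum by 1.\<close>

lemma power_tail_bound:
  assumes z: "cmod z < 1" and u: "(\<Sum>j<M. (cmod (u j))\<^sup>2) \<le> 1"
  shows "(cmod (\<Sum>j<M. if N \<le> j then u j * z ^ j else 0))\<^sup>2 * (1 - (cmod z)\<^sup>2) \<le> (cmod z ^ N)\<^sup>2"
proof -
  define t where "t = (cmod z)\<^sup>2"
  have t: "0 \<le> t" "t < 1" using z abs_square_less_1[of "cmod z"] by (auto simp: t_def)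
  have "cmod (\<Sum>j<M. if N \<le> j then u j * z ^ j else 0) \<le> (\<Sum>j<M. cmod (u j) * (if N \<le> j then cmod z ^ j else 0))"
    by (intro order_trans[OF norm_sum] sum_mono) (auto simp: norm_mult norm_power)
  then have "(cmod (\<Sum>j<M. if N \<le> j then u j * z ^ j else 0))\<^sup>2 \<le> (\<Sum>j<M. cmod (u j) * (if N \<le> j then cmod z ^ j else 0))\<^sup>2"
    by (rule power_mono) simp
  also have "\<dots> \<le> (\<Sum>j<M. (cmod (u j))\<^sup>2) * (\<Sum>j<M. (if N \<le> j then cmod z ^ j else 0)\<^sup>2)"
    by (rule Cauchy_Schwarz_ineq_sum)
  also have "\<dots> \<le> 1 * (\<Sum>j<M. (if N \<le> j then cmod z ^ j else 0)\<^sup>2)"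
    by (intro mult_right_mono u sum_nonneg) auto
  also have "(\<Sum>j<M. (if N \<le> j then cmod z ^ j else 0)\<^sup>2) = (\<Sum>j<M. if N \<le> j then t ^ j else 0)"
    by (intro sum.cong) (auto simp: t_def power2_eq_square power_mult_distrib)
  finally have "(cmod (\<Sum>j<M. if N \<le> j then u j * z ^ j else 0))\<^sup>2 * (1 - t) \<le> (\<Sum>j<M. if N \<le> j then t ^ j else 0) * (1 - t)"
    using t by (intro mult_right_mono) auto
  also have "\<dots> \<le> t ^ N"
  proof -
    have "(\<Sum>j<K. if N \<le> j then t ^ j else 0) * (1 - t) = (if N \<le> K then t ^ N - t ^ K else 0)" for K
    proof (induction K)
      case (Suc K)
      then show ?case using t by (cases "Suc K = N") (auto simp: algebra_simps le_Suc_eq)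
    qed simp
    then show ?thesis using t by simp
  qed
  also have "\<dots> = (cmod z ^ N)\<^sup>2" by (simp add: t_def power_mult[symmetric] mult.commute)
  finally show ?thesis by (simp add: t_def)
qed

text \<open>The operator is an integral of rank one matrices
  \<open>q z * (1 - (cmod z)\<^sup>2) * z ^ i * z ^ j\<close> of norm at most \<open>cmod (q z)\<close>.\<close>

locale disc_representation =
  fixes q :: "complex \<Rightarrow> complex" and H :: "nat \<Rightarrow> nat \<Rightarrow> complex"
  assumes q_int: "integrable lborel q" and q_supp: "1 \<le> cmod z \<Longrightarrow> q z = 0"
    and H_eq: "H i j = (LINT z|lborel. q z * of_real (1 - (cmod z)\<^sup>2) * z ^ (i + j))"
begin

text \<open>The function \<open>k\<close> enters the estimate and may become small with a parameter;
  the constant \<open>K\<close> serves integrability. Bounds inside the disc suffice, since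
  \<open>q\<close> vanishes outside it.\<close>

lemma q_times_bounded:
  assumes f: "continuous_on UNIV f" and k: "continuous_on UNIV k"
    and fk: "\<And>z. cmod z < 1 \<Longrightarrow> cmod (f z) \<le> k z" and kK: "\<And>z. cmod z < 1 \<Longrightarrow> k z \<le> K"
  shows "integrable lborel (\<lambda>z. q z * f z)"
    and "cmod (LINT z|lborel. q z * f z) \<le> (LINT z|lborel. cmod (q z) * k z)"
proof -
  have [measurable]: "q \<in> borel_measurable borel" "f \<in> borel_measurable borel" "k \<in> borel_measurable borel"
    using borel_measurable_integrable[OF q_int] f k by (auto intro: borel_measurable_continuous_onI)
  have le1: "cmod (q z * f z) \<le> cmod (q z) * k z" for z
    using fk[of z] q_supp[of z] by (cases "cmod z < 1") (auto simp: norm_mult intro: mult_left_mono)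
  have le2: "cmod (q z) * \<bar>k z\<bar> \<le> K * cmod (q z)" for z
    using order_trans[OF norm_ge_zero fk[of z]] kK[of z] q_supp[of z]
    by (cases "cmod z < 1") (auto simp: mult.commute[of K] intro: mult_left_mono)
  have ik: "integrable lborel (\<lambda>z. cmod (q z) * k z)"
  proof (rule Bochner_Integration.integrable_bound)
    show "integrable lborel (\<lambda>z. K * cmod (q z))" using q_int by auto
    show "AE z in lborel. norm (cmod (q z) * k z) \<le> norm (K * cmod (q z))"
    proof (rule AE_I2)
      fix z
      have "norm (cmod (q z) * k z) = cmod (q z) * \<bar>k z\<bar>" by (simp add: abs_mult)
      also note le2
      finally show "norm (cmod (q z) * k z) \<le> norm (K * cmod (q z))" by simp
    qed
  qed measurable
  show "integrable lborel (\<lambda>z. q z * f z)"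
    by (rule Bochner_Integration.integrable_bound[OF ik]) (use le1 in \<open>auto intro: order_trans[OF _ abs_ge_self]\<close>)
  then show "cmod (LINT z|lborel. q z * f z) \<le> (LINT z|lborel. cmod (q z) * k z)"
    by (intro order_trans[OF integral_norm_bound] integral_mono integrable_norm ik le1)
qed

text \<open>The quantities to be estimated are linear in finitely many entries. This reduces them to
  pointwise bounds for the rank one matrices z^(i + j).\<close>

lemma H_combination:
  "(\<Sum>i<M. \<Sum>j<M. a i j * H i j) =
    (LINT z|lborel. q z * (of_real (1 - (cmod z)\<^sup>2) * (\<Sum>i<M. \<Sum>j<M. a i j * z ^ (i + j))))"
proof -
  have int: "integrable lborel (\<lambda>z. q z * (of_real (1 - (cmod z)\<^sup>2) * z ^ n))" for n
  proof (rule q_times_bounded(1)[where k = "\<lambda>_. 1" and K = 1])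
    fix z :: complex assume z: "cmod z < 1"
    then have "(cmod z)\<^sup>2 \<le> 1" by (simp add: power_le_one)
    then show "cmod (of_real (1 - (cmod z)\<^sup>2) * z ^ n) \<le> 1"
      using z unfolding norm_mult norm_of_real norm_power by (intro mult_le_one) (auto simp: power_le_one)
  qed (auto intro!: continuous_intros)
  have "(LINT z|lborel. q z * (of_real (1 - (cmod z)\<^sup>2) * (\<Sum>i<M. \<Sum>j<M. a i j * z ^ (i + j))))
      = (LINT z|lborel. (\<Sum>i<M. \<Sum>j<M. a i j * (q z * (of_real (1 - (cmod z)\<^sup>2) * z ^ (i + j)))))"
    by (simp only: sum_distrib_left mult.left_commute[of _ "a _ _"])
  also have "\<dots> = (\<Sum>i<M. \<Sum>j<M. a i j * (LINT z|lborel. q z * (of_real (1 - (cmod z)\<^sup>2) * z ^ (i + j))))"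
    by (simp only: Bochner_Integration.integral_sum Bochner_Integration.integrable_sum integrable_mult_right[OF int] integral_mult_right_zero)
  finally show ?thesis by (simp only: H_eq mult.assoc)
qed

text \<open>Off the block either i \<ge> N, or i < N and j \<ge> N. On each of these two parts the
  form of z^(i + j) is a product in which one factor is a tail, worth |z|^N; the factor 2 counts the
  parts.\<close>

lemma mat_norm_truncation:
  "mat_norm (\<lambda>i j. H i j - (if i < N \<and> j < N then H i j else 0)) \<le> ennreal (2 * (LINT z|lborel. cmod (q z) * cmod z ^ N))"
  unfolding mat_norm_def
proof (rule SUP_least, clarify, rule ennreal_leI)
  fix M :: nat and u v :: "nat \<Rightarrow> complex"
  assume u: "(\<Sum>j<M. (cmod (u j))\<^sup>2) \<le> 1" and v: "(\<Sum>i<M. (cmod (v i))\<^sup>2) \<le> 1"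
  let ?a = "\<lambda>i j. if i < N \<and> j < N then 0 else cnj (v i) * u j"
  let ?s = "\<lambda>z. 1 - (cmod z)\<^sup>2"
  let ?P = "\<lambda>K u z. \<Sum>j<M. if K \<le> j then u j * z ^ j else 0"
  let ?v = "\<lambda>i. if i < N then cnj (v i) else 0"
  have v': "(\<Sum>i<M. (cmod (?v i))\<^sup>2) \<le> 1"
    by (rule order_trans[OF sum_mono v]) auto
  have v'': "(\<Sum>i<M. (cmod (cnj (v i)))\<^sup>2) \<le> 1" using v by simp
  have split: "(\<Sum>i<M. \<Sum>j<M. ?a i j * z ^ (i + j)) = ?P N (\<lambda>i. cnj (v i)) z * ?P 0 u z + ?P 0 ?v z * ?P N u z" for z
    unfolding sum_product sum.distrib[symmetric] by (intro sum.cong refl) (auto simp: power_add)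
  \<comment> \<open>The weight \<open>s\<close> is shared between the factors, a square root to
    each, so every squared factor carries one \<open>s\<close>.\<close>
  have prod: "cmod p * cmod r * s \<le> a" if "(cmod p)\<^sup>2 * s \<le> a\<^sup>2" "(cmod r)\<^sup>2 * s \<le> 1" "0 \<le> s" "0 \<le> a" for p r :: complex and s a
  proof (rule power2_le_imp_le)
    have "(cmod p * cmod r * s)\<^sup>2 = ((cmod p)\<^sup>2 * s) * ((cmod r)\<^sup>2 * s)" by (simp add: power2_eq_square mult_ac)
    also have "\<dots> \<le> a\<^sup>2 * 1" using that by (intro mult_mono) auto
    finally show "(cmod p * cmod r * s)\<^sup>2 \<le> a\<^sup>2" by simp
  qed (use that in simp)
  have bound: "cmod (of_real (?s z) * (\<Sum>i<M. \<Sum>j<M. ?a i j * z ^ (i + j))) \<le> 2 * cmod z ^ N" if z: "cmod z < 1" for z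
  proof -
    have s: "0 \<le> ?s z" using z by (simp add: power_le_one)
    have "cmod (of_real (?s z) * (\<Sum>i<M. \<Sum>j<M. ?a i j * z ^ (i + j))) = ?s z * cmod (?P N (\<lambda>i. cnj (v i)) z * ?P 0 u z + ?P 0 ?v z * ?P N u z)"
      unfolding split norm_mult norm_of_real using s by simp
    also have "\<dots> \<le> ?s z * (cmod (?P N (\<lambda>i. cnj (v i)) z) * cmod (?P 0 u z) + cmod (?P 0 ?v z) * cmod (?P N u z))"
      using s by (intro mult_left_mono) (simp_all only: norm_mult[symmetric] norm_triangle_ineq)
    also have "\<dots> = cmod (?P N (\<lambda>i. cnj (v i)) z) * cmod (?P 0 u z) * ?s z + cmod (?P N u z) * cmod (?P 0 ?v z) * ?s z"
      by (simp only: distrib_left mult_ac)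
    also have "\<dots> \<le> cmod z ^ N + cmod z ^ N"
      using power_tail_bound[OF z v'', of N] power_tail_bound[OF z u, of 0] power_tail_bound[OF z v', of 0] power_tail_bound[OF z u, of N] s
      by (intro add_mono prod) (simp_all only: power_0 power_one zero_le_power norm_ge_zero)
    finally show ?thesis by simp
  qed
  have "(\<Sum>i<M. \<Sum>j<M. cnj (v i) * (H i j - (if i < N \<and> j < N then H i j else 0)) * u j) = (\<Sum>i<M. \<Sum>j<M. ?a i j * H i j)"
    by (intro sum.cong refl) auto
  also have "cmod \<dots> \<le> (LINT z|lborel. cmod (q z) * (2 * cmod z ^ N))"
    unfolding H_combination
    by (rule q_times_bounded(2)[where K = 2]) (use bound in \<open>auto intro!: continuous_intros power_le_one\<close>)
  also have "\<dots> = 2 * (LINT z|lborel. cmod (q z) * cmod z ^ N)"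
    by (simp only: mult.left_commute[of _ 2] integral_mult_right_zero)
  finally show "cmod (\<Sum>i<M. \<Sum>j<M. cnj (v i) * (H i j - (if i < N \<and> j < N then H i j else 0)) * u j)
    \<le> 2 * (LINT z|lborel. cmod (q z) * cmod z ^ N)" .
qed

text \<open>The sum is a sum of forms at the singular pairs, hence linear in the entries. On the
  matrix z^(i + j) Bessel's inequality for both families bounds it by the sum of the |z|^(2 i), and
  the weight brings this down to 1, whatever \<open>K\<close> and \<open>N\<close> are.\<close>

lemma sum_singular_values_le:
  assumes "deflation N A \<sigma> x y" and A: "\<And>i j. i < N \<Longrightarrow> j < N \<Longrightarrow> A i j = H i j"
  shows "(\<Sum>k<K. \<sigma> k) \<le> (LINT z|lborel. cmod (q z))"
proof -
  interpret deflation N A \<sigma> x y by fact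
  let ?a = "\<lambda>i j. \<Sum>k<K. cnj (y k i) * x k j"
  let ?s = "\<lambda>z. 1 - (cmod z)\<^sup>2"
  have "of_real (\<Sum>k<K. \<sigma> k) = (\<Sum>k<K. bil N A (y k) (x k))"
    by (simp add: bil_singular)
  also have "\<dots> = (\<Sum>k<K. \<Sum>i<N. \<Sum>j<N. (cnj (y k i) * x k j) * H i j)"
    unfolding bil_def by (intro sum.cong refl) (simp add: A)
  also have "\<dots> = (\<Sum>i<N. \<Sum>k<K. \<Sum>j<N. (cnj (y k i) * x k j) * H i j)" by (rule sum.swap)
  also have "\<dots> = (\<Sum>i<N. \<Sum>j<N. \<Sum>k<K. (cnj (y k i) * x k j) * H i j)"
    by (intro sum.cong refl sum.swap)
  also have "\<dots> = (\<Sum>i<N. \<Sum>j<N. ?a i j * H i j)" by (simp only: sum_distrib_right)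
  finally have eq: "complex_of_real (\<Sum>k<K. \<sigma> k) = (\<Sum>i<N. \<Sum>j<N. ?a i j * H i j)" .
  have bound: "cmod (of_real (?s z) * (\<Sum>i<N. \<Sum>j<N. ?a i j * z ^ (i + j))) \<le> 1" if z: "cmod z < 1" for z
  proof -
    define t where "t = (cmod z)\<^sup>2"
    have t: "0 \<le> t" "t < 1" using z abs_square_less_1[of "cmod z"] by (auto simp: t_def)
    \<comment> \<open>The right vectors enter unconjugated, so their pairing with the powers of z is
      the conjugate of an inner product with the powers of \<open>cnj z\<close>.\<close>
    let ?Z = "\<lambda>i. z ^ i" and ?W = "\<lambda>i. cnj z ^ i"
    have nZ: "nsq N ?Z = (\<Sum>i<N. t ^ i)" "nsq N ?W = (\<Sum>i<N. t ^ i)"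
      by (simp_all add: nsq_def norm_power t_def power_mult[symmetric] mult.commute)
    have "(\<Sum>i<N. \<Sum>j<N. ?a i j * z ^ (i + j)) = (\<Sum>i<N. \<Sum>j<N. \<Sum>k<K. (cnj (y k i) * z ^ i) * (x k j * z ^ j))"
      by (simp add: sum_distrib_left sum_distrib_right power_add mult_ac)
    also have "\<dots> = (\<Sum>i<N. \<Sum>k<K. \<Sum>j<N. (cnj (y k i) * z ^ i) * (x k j * z ^ j))"
      by (intro sum.cong refl sum.swap)
    also have "\<dots> = (\<Sum>k<K. \<Sum>i<N. \<Sum>j<N. (cnj (y k i) * z ^ i) * (x k j * z ^ j))" by (rule sum.swap)
    also have "\<dots> = (\<Sum>k<K. ip N (y k) ?Z * cnj (ip N (x k) ?W))"
      by (simp add: ip_def sum_product)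
    finally have "cmod (\<Sum>i<N. \<Sum>j<N. ?a i j * z ^ (i + j)) \<le> (\<Sum>k<K. cmod (ip N (y k) ?Z * cnj (ip N (x k) ?W)))"
      by (simp only: norm_sum)
    also have "\<dots> \<le> (\<Sum>k<K. ((cmod (ip N (y k) ?Z))\<^sup>2 + (cmod (ip N (x k) ?W))\<^sup>2) / 2)"
    proof (rule sum_mono)
      fix k
      show "cmod (ip N (y k) ?Z * cnj (ip N (x k) ?W)) \<le> ((cmod (ip N (y k) ?Z))\<^sup>2 + (cmod (ip N (x k) ?W))\<^sup>2) / 2"
        using sum_squares_bound[of "cmod (ip N (y k) ?Z)" "cmod (ip N (x k) ?W)"] by (simp add: norm_mult)
    qed
    also have "\<dots> = ((\<Sum>k<K. (cmod (ip N (y k) ?Z))\<^sup>2) + (\<Sum>k<K. (cmod (ip N (x k) ?W))\<^sup>2)) / 2"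
      by (simp only: sum.distrib sum_divide_distrib[symmetric])
    also have "\<dots> \<le> (nsq N ?Z + nsq N ?W) / 2"
      by (intro divide_right_mono add_mono bessel orthogonal nsq_le_1) auto
    also have "\<dots> = (\<Sum>i<N. t ^ i)" by (simp add: nZ)
    finally have 1: "cmod (\<Sum>i<N. \<Sum>j<N. ?a i j * z ^ (i + j)) \<le> (\<Sum>i<N. t ^ i)" .
    have "cmod (of_real (?s z) * (\<Sum>i<N. \<Sum>j<N. ?a i j * z ^ (i + j))) = (1 - t) * cmod (\<Sum>i<N. \<Sum>j<N. ?a i j * z ^ (i + j))"
      unfolding norm_mult norm_of_real using t by (simp add: t_def[symmetric])
    also have "\<dots> \<le> (1 - t) * (\<Sum>i<N. t ^ i)" using 1 t by (intro mult_left_mono) auto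
    also have "\<dots> = 1 - t ^ N" by (rule one_diff_power_eq[symmetric])
    also have "\<dots> \<le> 1" using t by simp
    finally show ?thesis .
  qed
  have "(\<Sum>k<K. \<sigma> k) = cmod (complex_of_real (\<Sum>k<K. \<sigma> k))"
    unfolding norm_of_real by (simp add: sum_nonneg \<sigma>_nonneg)
  also have "\<dots> \<le> (LINT z|lborel. cmod (q z) * 1)"
    unfolding eq H_combination
    by (rule q_times_bounded(2)[where K = 1]) (use bound in \<open>auto intro!: continuous_intros\<close>)
  finally show ?thesis by simp
qed

lemma trace_norm_le: "trace_norm H \<le> ennreal (LINT z|lborel. cmod (q z))"
proof -
  define \<epsilon> where "\<epsilon> N = 2 * (LINT z|lborel. cmod (q z) * cmod z ^ N)" for N
  have \<epsilon>_nonneg: "0 \<le> \<epsilon> N" for N by (simp add: \<epsilon>_def)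
  let ?I = "LINT z|lborel. cmod (q z)"
  have "(\<lambda>N. LINT z|lborel. cmod (q z) * cmod z ^ N) \<longlonglongrightarrow> (LINT z|(lborel :: complex measure). (0::real))"
  proof (rule integral_dominated_convergence[where w = "\<lambda>z. cmod (q z)"])
    have [measurable]: "q \<in> borel_measurable borel" using borel_measurable_integrable[OF q_int] by simp
    have [measurable]: "(\<lambda>z::complex. cmod z ^ N) \<in> borel_measurable borel" for N
      by (intro borel_measurable_continuous_onI continuous_intros)
    show "(\<lambda>z. cmod (q z) * cmod z ^ N) \<in> borel_measurable lborel" for N by measurable
    show "AE z in lborel. (\<lambda>N. cmod (q z) * cmod z ^ N) \<longlonglongrightarrow> 0"
    proof (rule AE_I2)
      fix z
      show "(\<lambda>N. cmod (q z) * cmod z ^ N) \<longlonglongrightarrow> 0"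
        using q_supp[of z] by (cases "cmod z < 1") (auto intro!: tendsto_mult_right_zero LIMSEQ_power_zero)
    qed
    show "AE z in lborel. norm (cmod (q z) * cmod z ^ N) \<le> cmod (q z)" for N
    proof (rule AE_I2)
      fix z
      show "norm (cmod (q z) * cmod z ^ N) \<le> cmod (q z)"
        using q_supp[of z] by (cases "cmod z < 1") (auto simp: power_le_one mult_left_le)
    qed
  qed (use q_int in auto)
  then have \<epsilon>0: "\<epsilon> \<longlonglongrightarrow> 0"
    unfolding \<epsilon>_def using tendsto_mult_left[of _ 0 sequentially 2] by simp
  have partial: "(\<Sum>n<K. sing_num H n) \<le> ennreal (real K * \<epsilon> N + ?I)" for K N
  proof -
    define A where "A i j = (if i < N \<and> j < N then H i j else 0)" for i j
    obtain \<sigma> x y where d: "deflation N A \<sigma> x y" by (rule deflation_exists)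
    then interpret deflation N A \<sigma> x y .
    have "sing_num H n \<le> ennreal (\<epsilon> N) + ennreal (\<sigma> n)" for n
    proof -
      \<comment> \<open>\<open>F\<close> keeps the first \<open>n\<close> singular terms of the
        truncation, so \<open>H\<close> minus \<open>F\<close> is the truncation error plus the
        residual \<open>B n\<close>.\<close>
      define F where "F i j = (\<Sum>l<n. (of_real (\<sigma> l) * y l i) * cnj (x l j))" for i j
      have "rank_le n F"
        unfolding rank_le_def
      proof (rule exI[of _ "\<lambda>l i. of_real (\<sigma> l) * y l i"], rule exI[of _ "\<lambda>l j. cnj (x l j)"], intro conjI allI impI)
        show "(\<lambda>i. of_real (\<sigma> k) * y k i) \<in> ell2" "(\<lambda>j. cnj (x k j)) \<in> ell2" for k
          by (rule finite_support_ell2[of N], simp add: support)+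
      qed (simp add: F_def)
      then have "sing_num H n \<le> mat_norm (\<lambda>i j. H i j - F i j)"
        unfolding sing_num_def by (intro INF_lower) simp
      also have "(\<lambda>i j. H i j - F i j) = (\<lambda>i j. (H i j - A i j) + B n i j)"
        by (simp add: F_def deflate_def fun_eq_iff)
      also have "mat_norm \<dots> \<le> mat_norm (\<lambda>i j. H i j - A i j) + mat_norm (B n)"
        by (rule mat_norm_add)
      also have "\<dots> \<le> ennreal (\<epsilon> N) + ennreal (\<sigma> n)"
        using mat_norm_truncation[of N] by (intro add_mono mat_norm_deflate) (auto simp: A_def \<epsilon>_def)
      finally show ?thesis .
    qed
    then have "(\<Sum>n<K. sing_num H n) \<le> (\<Sum>n<K. ennreal (\<epsilon> N + \<sigma> n))"
      by (intro sum_mono) (simp add: ennreal_plus \<epsilon>_nonneg \<sigma>_nonneg)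
    also have "\<dots> = ennreal (real K * \<epsilon> N + (\<Sum>n<K. \<sigma> n))"
      by (subst sum_ennreal) (auto simp: \<epsilon>_nonneg \<sigma>_nonneg sum.distrib)
    also have "\<dots> \<le> ennreal (real K * \<epsilon> N + ?I)"
      using sum_singular_values_le[OF d] by (intro ennreal_leI add_left_mono) (simp add: A_def)
    finally show ?thesis .
  qed
  \<comment> \<open>\<open>K\<close> stays fixed while \<open>N\<close> tends to infinity, so the
    accumulated error \<open>real K * \<epsilon> N\<close> vanishes.\<close>
  have "(\<Sum>n<K. sing_num H n) \<le> ennreal ?I" for K
  proof (rule LIMSEQ_le_const)
    have "(\<lambda>N. real K * \<epsilon> N + ?I) \<longlonglongrightarrow> real K * 0 + ?I" by (intro tendsto_intros \<epsilon>0)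
    then show "(\<lambda>N. ennreal (real K * \<epsilon> N + ?I)) \<longlonglongrightarrow> ennreal ?I"
      by (intro tendsto_ennrealI) simp
  qed (use partial in auto)
  then show ?thesis
    unfolding trace_norm_def suminf_eq_SUP by (intro SUP_least)
qed

end

subsection \<open>The equivalence\<close>

theorem theorem3p1:
  fixes c :: "nat \<Rightarrow> complex"
  assumes "bounded (range c)"
  defines "H \<equiv> (\<lambda>i j. c (i + j))"
    and "g \<equiv> (\<lambda>z. \<Sum>n. of_nat ((n + 2) * (n + 1)) * c n * z ^ n)"
  shows "(trace_class H \<longleftrightarrow> set_integrable lborel (ball 0 1) g) \<and>
    (trace_class H \<longrightarrow>
       (\<forall>i j. H i j = complex_of_real (1 / pi) *
           (LINT z:ball 0 1|lborel. g (cnj z) * z ^ (i + j) * complex_of_real (1 - (cmod z)^2))) \<and>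
       trace_norm H \<le> disc_L1_norm g \<and>
       disc_L1_norm g \<le> ennreal (8 / pi) * trace_norm H)"
proof -
  obtain C where C: "\<And>n. cmod (c n) \<le> C"
    using assms(1) unfolding bounded_iff by auto
  have lower: "disc_L1_norm g \<le> ennreal (8 / pi) * trace_norm H"
    unfolding g_def H_def by (rule disc_L1_norm_le_trace_norm[OF C])
  \<comment> \<open>Continuity makes \<open>g\<close> measurable on the disc, so that a finite
    \<open>disc_L1_norm\<close> amounts to integrability.\<close>
  have cont: "continuous_on (ball 0 1) g"
  proof -
    have "isCont g z" if "cmod z < 1" for z
      unfolding g_def
    proof (rule isCont_powser)
      \<comment> \<open>A radius strictly between |z| and 1; the series converges there because
        \<open>c\<close> is bounded.\<close>
      define r where "r = (1 + cmod z) / 2"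
      have r: "cmod z < r" "0 \<le> r" "r < 1" using that by (auto simp: r_def)
      show "summable (\<lambda>n. (of_nat ((n + 2) * (n + 1)) * c n) * complex_of_real r ^ n)"
      proof (rule summable_comparison_test)
        show "summable (\<lambda>n. C * (real ((n + 2) * (n + 1)) * r ^ n))"
          using r by (intro summable_mult summable_quadratic_power) simp
        have "norm (of_nat ((n + 2) * (n + 1)) * c n * complex_of_real r ^ n) \<le> C * (real ((n + 2) * (n + 1)) * r ^ n)" for n
        proof -
          have "norm (of_nat ((n + 2) * (n + 1)) * c n * complex_of_real r ^ n) = cmod (c n) * (real ((n + 2) * (n + 1)) * r ^ n)"
            using r(2) by (simp only: norm_mult norm_of_nat norm_power norm_of_real abs_of_nonneg mult_ac)
          also have "\<dots> \<le> C * (real ((n + 2) * (n + 1)) * r ^ n)"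
            using r by (intro mult_right_mono C) auto
          finally show ?thesis .
        qed
        then show "\<exists>N. \<forall>n\<ge>N. norm (of_nat ((n + 2) * (n + 1)) * c n * complex_of_real r ^ n) \<le> C * (real ((n + 2) * (n + 1)) * r ^ n)"
          by blast
      qed
      show "norm z < norm (complex_of_real r)" using r by simp
    qed
    then show ?thesis by (intro continuous_at_imp_continuous_on) simp
  qed
  have meas: "(\<lambda>z. indicator (ball 0 1) z *\<^sub>R g z) \<in> borel_measurable lborel"
    unfolding measurable_lborel2 using cont by (intro borel_measurable_continuous_on_indicator) auto
  have L1: "disc_L1_norm g = ennreal (1 / pi) * (\<integral>\<^sup>+ z. ennreal (norm (indicator (ball 0 1) z *\<^sub>R g z)) \<partial>lborel)"
    unfolding disc_L1_norm_def by (intro arg_cong2[of _ _ _ _ "(*)"] nn_integral_cong refl) (simp add: indicator_def)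
  have fin: "disc_L1_norm g < \<infinity> \<longleftrightarrow> set_integrable lborel (ball 0 1) g"
    using meas unfolding set_integrable_def integrable_iff_bounded L1
    by (auto simp: ennreal_mult_less_top ennreal_eq_0_iff not_le[THEN iffD2, OF pi_gt_zero])
  have formula: "H i j = complex_of_real (1 / pi) *
      (LINT z:ball 0 1|lborel. g (cnj z) * z ^ (i + j) * complex_of_real (1 - (cmod z)^2))"
    if "set_integrable lborel (ball 0 1) g" for i j
    using coefficient_integral[OF C that[unfolded g_def], of "i + j"] by (simp add: H_def g_def)
  have upper: "trace_norm H \<le> disc_L1_norm g" if int: "set_integrable lborel (ball 0 1) g"
  proof -
    \<comment> \<open>The factor 1 / pi and the conjugation of the integral formula are absorbed
      into \<open>q\<close>. Conjugation preserves Lebesgue measure, so the integral of |q| is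
      exactly \<open>disc_L1_norm g\<close>.\<close>
    define q where "q z = indicator (ball 0 1) z *\<^sub>R (of_real (1 / pi) * g (cnj z))" for z
    interpret disc_representation q H
    proof
      show "integrable lborel q"
        using set_integrable_mult_right[OF set_integrable_disc_cnj[OF int], of "of_real (1 / pi)"]
        unfolding q_def set_integrable_def by simp
      show "q z = 0" if "1 \<le> cmod z" for z using that by (simp add: q_def)
      show "H i j = (LINT z|lborel. q z * of_real (1 - (cmod z)\<^sup>2) * z ^ (i + j))" for i j
      proof -
        have "H i j = (LINT z:ball 0 1|lborel. of_real (1 / pi) * (g (cnj z) * z ^ (i + j) * complex_of_real (1 - (cmod z)^2)))"
          unfolding set_integral_mult_right by (rule formula[OF int])
        also have "\<dots> = (LINT z|lborel. q z * of_real (1 - (cmod z)\<^sup>2) * z ^ (i + j))"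
          unfolding set_lebesgue_integral_def by (intro Bochner_Integration.integral_cong) (auto simp: q_def indicator_def)
        finally show ?thesis .
      qed
    qed
    have intn: "set_integrable lborel (ball 0 1) (\<lambda>z. cmod (g z))"
      using set_integrable_norm[OF int] .
    have "(LINT z|lborel. cmod (q z)) = (LINT z:ball 0 1|lborel. (1 / pi) * cmod (g (cnj z)))"
      unfolding set_lebesgue_integral_def by (intro Bochner_Integration.integral_cong) (auto simp: q_def norm_mult norm_divide indicator_def)
    also have "\<dots> = (1 / pi) * (LINT z:ball 0 1|lborel. cmod (g z))"
    proof (subst set_integral_mult_right, subst set_integral_ball_isometry[OF lborel_distr_cnj, where f = "\<lambda>z. cmod (g z)"])
      show "cnj \<in> borel_measurable borel" by (intro borel_measurable_continuous_onI continuous_intros)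
      show "(\<lambda>z. indicator (ball 0 1) z *\<^sub>R cmod (g z)) \<in> borel_measurable borel"
        using borel_measurable_integrable[OF intn[unfolded set_integrable_def]] by simp
    qed auto
    finally have "ennreal (LINT z|lborel. cmod (q z)) = ennreal (1 / pi) * ennreal (LINT z:ball 0 1|lborel. cmod (g z))"
      by (simp only:) (intro ennreal_mult, auto simp: set_lebesgue_integral_def intro!: Bochner_Integration.integral_nonneg)
    also have "ennreal (LINT z:ball 0 1|lborel. cmod (g z)) = (\<integral>\<^sup>+ z. ennreal (norm (indicator (ball 0 1) z *\<^sub>R g z)) \<partial>lborel)"
      unfolding set_lebesgue_integral_def using intn unfolding set_integrable_def
      by (subst nn_integral_eq_integral[symmetric]) (auto simp: indicator_def)
    finally show ?thesis using trace_norm_le by (simp only: L1)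
  qed
  have "trace_class H \<longleftrightarrow> set_integrable lborel (ball 0 1) g"
  proof
    assume "trace_class H"
    then have "ennreal (8 / pi) * trace_norm H < \<infinity>"
      by (simp add: trace_class_def ennreal_mult_less_top)
    with lower have "disc_L1_norm g < \<infinity>" by (rule le_less_trans)
    then show "set_integrable lborel (ball 0 1) g" by (simp only: fin)
  next
    assume "set_integrable lborel (ball 0 1) g"
    then show "trace_class H"
      unfolding trace_class_def using upper fin by (metis le_less_trans)
  qed
  then show ?thesis using formula upper lower by blast
qed

end
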